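(* Let $n\geq 2$, let $\mathbb{K}$ be a field, and let $m\geq 1$. An $m$-fold extension $f\colon\mathscr{B}\to\mathscr{A}$ in the category of Leibniz $n$-algebras over $\mathbb{K}$ is central (with respect to the subcategory of $\mathbb{K}$-vector spaces, i.e. abelian Leibniz $n$-algebras) if and only if the object $$\sum_{I_{1}\cup\dots\cup I_{n}=\langle m\rangle}\Bigl[\bigcap_{i\in I_{1}}K[f_{i}],\dots,\bigcap_{i\in I_{n}}K[f_{i}]\Bigr]$$ is zero. Hence, for any $m$-fold extension $f$ (central or not), this object is equal to $L_{m}[f]$.
   Context: A Leibniz $n$-algebra over $\mathbb{K}$ is a $\mathbb{K}$-vector space $\mathscr{L}$ with an $n$-linear operation $[-,\dots,-]\colon\mathscr{L}^n\to\mathscr{L}$ satisfying $$[[l_{1},\dots,l_{n}],l'_{1},\dots,l'_{n-1}]=\sum_{1\leq i\leq n}[l_{1},\dots,l_{i-1},[l_{i},l'_{1},\dots,l'_{n-1}],l_{i+1},\dots,l_{n}].$$ Homomorphisms are linear maps preserving the bracket. Ideals are $n$-sided: a subspace $\mathscr{N}$ such that $[l_1,\dots,l_n]\in\mathscr{N}$ whenever some $l_i\in\mathscr{N}$. A vector space is regarded as a Leibniz $n$-algebra with zero bracket ("abelian"). For ideals $\mathscr{N}_1,\dots,\mathscr{N}_n$ of $\mathscr{L}$, $[\mathscr{N}_1,\dots,\mathscr{N}_n]$ denotes the ideal of $\mathscr{L}$ generated by the elements $[l_1,\dots,l_n]$ where $(l_1,\dots,l_n)$ or any of its permutations is in $\mathscr{N}_1\times\dots\times\mathscr{N}_n$.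 The left adjoint of the inclusion of vector spaces into Leibniz $n$-algebras is $\mathscr{L}\mapsto\mathscr{L}/[\mathscr{L},\dots,\mathscr{L}]$. Higher extensions. Let $\langle m\rangle=\{1,\dots,m\}$, $\langle 0\rangle=\varnothing$. An $m$-fold arrow is a functor $f$ from the poset of subsets of $\langle m\rangle$ (ordered by inclusion) to the category; write $f_I=f(I)$, and $f_i\colon f_\varnothing\to f_{\{i\}}$ for the map induced by $\varnothing\subseteq\{i\}$; $K[f_i]$ is the kernel of $f_i$, an ideal of $f_\varnothing$. An $m$-fold arrow $f$ is an $m$-fold extension if for all $I\subsetneq\langle m\rangle$ the induced map $f_I\to\lim_{J\supsetneq I}f_J$ is surjective; a $0$-fold extension is just an object. For $m\geq1$, $f$ is viewed as a morphism $f\colon\mathscr{B}\to\mathscr{A}$ of $(m-1)$-fold arrows, with $\mathscr{B}_I=f_I$ and $\mathscr{A}_I=f_{I\cup\{m\}}$ for $I\subseteq\langle m-1\rangle$. Its kernel pair $R[f]$ is the $(m-1)$-fold extension with $R[f]_I=\{(x,y)\in\mathscr{B}_I\times\mathscr{B}_I$ : $x,y$ have the same image in $\mathscr{A}_I\}$, with projections $f_0,f_1\colon R[f]\to\mathscr{B}$ onto the first and second component. Higher centrality. Define inductively, for an $m$-fold extension $f$, an ideal $L_m[f]$ of $f_\varnothing$: $L_0[\mathscr{L}]=[\mathscr{L},\dots,\mathscr{L}]$, and for $m\geq 1$, $L_m[f]$ is the kernel of the restriction $L_{m-1}[R[f]]\to L_{m-1}[\mathscr{B}]$ of $(f_0)_\varnothing\colon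 R[f]_\varnothing\to\mathscr{B}_\varnothing$, viewed as an ideal of $f_\varnothing=\mathscr{B}_\varnothing$ via $(f_1)_\varnothing$; that is, $L_m[f]=\{k\in f_\varnothing:(0,k)\in L_{m-1}[R[f]]\}$. The $m$-fold extension $f$ is central if and only if the restrictions of $(f_0)_\varnothing$ and $(f_1)_\varnothing$ to maps $L_{m-1}[R[f]]\to L_{m-1}[\mathscr{B}]$ coincide. The sum in the claim is a sum of ideals of $f_\varnothing$, over all $n$-tuples $(I_1,\dots,I_n)$ of (possibly empty) subsets of $\langle m\rangle$ with union $\langle m\rangle$; an empty intersection means $f_\varnothing$. *)

theory Defs
  imports "HOL-Algebra.Module" "HOL-Algebra.AbelCoset" "HOL-Library.Multiset"
begin

section \<open>Leibniz n-algebras\<close>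

text \<open>As for \<open>module\<close>, the fields \<open>mult\<close> and \<open>one\<close> inherited from \<open>ring\<close> carry no meaning.
  The arguments of the bracket form a list; only lists of length \<open>n\<close> are relevant.\<close>

record ('k, 'a) leibniz = "('k, 'a) module" +
  bracket :: "'a list \<Rightarrow> 'a"

locale leibniz_algebra = module K L
  for n :: nat and K :: "('k, 'c) ring_scheme" and L :: "('k, 'a, 'd) leibniz_scheme" +
  assumes bracket_closed:
      "\<lbrakk>length xs = n; set xs \<subseteq> carrier L\<rbrakk> \<Longrightarrow> bracket L xs \<in> carrier L"
    and bracket_add:
      "\<lbrakk>length xs = n; set xs \<subseteq> carrier L; i < n; x \<in> carrier L; y \<in> carrier L\<rbrakk> \<Longrightarrow>
        bracket L (xs[i := x \<oplus>\<^bsub>L\<^esub> y]) = bracket L (xs[i := x]) \<oplus>\<^bsub>L\<^esub> bracket L (xs[i := y])"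
    and bracket_smult:
      "\<lbrakk>length xs = n; set xs \<subseteq> carrier L; i < n; a \<in> carrier K; x \<in> carrier L\<rbrakk> \<Longrightarrow>
        bracket L (xs[i := a \<odot>\<^bsub>L\<^esub> x]) = a \<odot>\<^bsub>L\<^esub> bracket L (xs[i := x])"
    and leibniz_identity:
      "\<lbrakk>length xs = n; set xs \<subseteq> carrier L; length ys = n - 1; set ys \<subseteq> carrier L\<rbrakk> \<Longrightarrow>
        bracket L (bracket L xs # ys) =
          (\<Oplus>\<^bsub>L\<^esub>i\<in>{..<n}. bracket L (xs[i := bracket L (xs ! i # ys)]))"

definition leibniz_hom ::
    "nat \<Rightarrow> ('k, 'c) ring_scheme \<Rightarrow> ('k, 'a, 'd) leibniz_scheme \<Rightarrow> ('k, 'b, 'e) leibniz_scheme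
      \<Rightarrow> ('a \<Rightarrow> 'b) set" where
  "leibniz_hom n K L M =
    {h \<in> carrier L \<rightarrow> carrier M.
      (\<forall>x\<in>carrier L. \<forall>y\<in>carrier L. h (x \<oplus>\<^bsub>L\<^esub> y) = h x \<oplus>\<^bsub>M\<^esub> h y) \<and>
      (\<forall>a\<in>carrier K. \<forall>x\<in>carrier L. h (a \<odot>\<^bsub>L\<^esub> x) = a \<odot>\<^bsub>M\<^esub> h x) \<and>
      (\<forall>xs. length xs = n \<and> set xs \<subseteq> carrier L \<longrightarrow>
        h (bracket L xs) = bracket M (map h xs))}"

definition leibniz_ideal ::
    "nat \<Rightarrow> ('k, 'c) ring_scheme \<Rightarrow> ('k, 'a, 'd) leibniz_scheme \<Rightarrow> 'a set \<Rightarrow> bool" where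
  "leibniz_ideal n K L N \<longleftrightarrow>
    submodule N K L \<and>
    (\<forall>xs. length xs = n \<and> set xs \<subseteq> carrier L \<and> (\<exists>x\<in>set xs. x \<in> N) \<longrightarrow> bracket L xs \<in> N)"

definition leibniz_genideal ::
    "nat \<Rightarrow> ('k, 'c) ring_scheme \<Rightarrow> ('k, 'a, 'd) leibniz_scheme \<Rightarrow> 'a set \<Rightarrow> 'a set" where
  "leibniz_genideal n K L S = \<Inter>{N. leibniz_ideal n K L N \<and> S \<subseteq> N}"

text \<open>The ideal \<open>[N\<^sub>1, \<dots>, N\<^sub>n]\<close>; equality of multisets says that \<open>ys\<close> is a permutation of \<open>xs\<close>.\<close>

definition commutator ::
    "nat \<Rightarrow> ('k, 'c) ring_scheme \<Rightarrow> ('k, 'a, 'd) leibniz_scheme \<Rightarrow> 'a set list \<Rightarrow> 'a set" where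
  "commutator n K L Ns =
    leibniz_genideal n K L
      {bracket L xs | xs. \<exists>ys. mset ys = mset xs \<and> list_all2 (\<in>) ys Ns}"

text \<open>The sum of a finite family of subspaces.\<close>

definition subspace_sum ::
    "('a, 'd) ring_scheme \<Rightarrow> 't set \<Rightarrow> ('t \<Rightarrow> 'a set) \<Rightarrow> 'a set" where
  "subspace_sum L T N = {(\<Oplus>\<^bsub>L\<^esub>t\<in>T. x t) | x. x \<in> (\<Pi> t\<in>T. N t)}"


section \<open>Higher extensions\<close>

text \<open>\<open>obj f I\<close> is \<open>f\<^sub>I\<close> and \<open>arr f I J\<close> is the map induced by \<open>I \<subseteq> J\<close>. Letting all the \<open>f\<^sub>I\<close> have
  carriers in one type \<open>'a\<close> is no restriction: there are finitely many of them, so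
  \<open>'a\<close> may be a disjoint union.\<close>

record ('k, 'a) fold_arrow =
  obj :: "nat set \<Rightarrow> ('k, 'a) leibniz"
  arr :: "nat set \<Rightarrow> nat set \<Rightarrow> 'a \<Rightarrow> 'a"

definition is_fold_arrow ::
    "nat \<Rightarrow> ('k, 'c) ring_scheme \<Rightarrow> nat \<Rightarrow> ('k, 'a) fold_arrow \<Rightarrow> bool" where
  "is_fold_arrow n K m f \<longleftrightarrow>
    (\<forall>I\<subseteq>{1..m}. leibniz_algebra n K (obj f I)) \<and>
    (\<forall>J\<subseteq>{1..m}. \<forall>I\<subseteq>J. arr f I J \<in> leibniz_hom n K (obj f I) (obj f J)) \<and>
    (\<forall>I\<subseteq>{1..m}. \<forall>x\<in>carrier (obj f I). arr f I I x = x) \<and>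
    (\<forall>H\<subseteq>{1..m}. \<forall>J\<subseteq>H. \<forall>I\<subseteq>J. \<forall>x\<in>carrier (obj f I).
      arr f J H (arr f I J x) = arr f I H x)"

text \<open>The underlying set of the limit of the \<open>f\<^sub>J\<close> over all \<open>J\<close> strictly containing \<open>I\<close>
  (limits of Leibniz n-algebras are computed on underlying sets).\<close>

definition strict_above :: "nat \<Rightarrow> nat set \<Rightarrow> nat set set" where
  "strict_above m I = {J. I \<subset> J \<and> J \<subseteq> {1..m}}"

definition punctured_limit ::
    "nat \<Rightarrow> ('k, 'a) fold_arrow \<Rightarrow> nat set \<Rightarrow> (nat set \<Rightarrow> 'a) set" where
  "punctured_limit m f I =
    {x \<in> (\<Pi>\<^sub>E J\<in>strict_above m I. carrier (obj f J)).
      \<forall>J\<in>strict_above m I. \<forall>H\<in>strict_above m I. J \<subseteq> H \<longrightarrow> arr f J H (x J) = x H}"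

definition is_fold_extension ::
    "nat \<Rightarrow> ('k, 'c) ring_scheme \<Rightarrow> nat \<Rightarrow> ('k, 'a) fold_arrow \<Rightarrow> bool" where
  "is_fold_extension n K m f \<longleftrightarrow>
    is_fold_arrow n K m f \<and>
    (\<forall>I. I \<subset> {1..m} \<longrightarrow>
      (\<lambda>x. \<lambda>J\<in>strict_above m I. arr f I J x) ` carrier (obj f I) = punctured_limit m f I)"

definition edge_kernel :: "('k, 'a) fold_arrow \<Rightarrow> nat \<Rightarrow> 'a set" where
  "edge_kernel f i = a_kernel (obj f {}) (obj f {i}) (arr f {} {i})"


section \<open>Higher centrality\<close>

text \<open>The recursion defining \<open>L\<^sub>m\<close> passes from \<open>f\<close> to its kernel pair, whose elements are pairs of
  elements of \<open>f\<close>. Since a recursive HOL function cannot change the type of the elements from \<open>'a\<close> to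
  \<open>'a \<times> 'a\<close>, the recursion takes place over the closure of \<open>'a\<close> under formal pairs \<open>Pr x y\<close>,
  into which algebras over \<open>'a\<close> are copied along \<open>Base\<close>. The selectors \<open>proj0\<close>, \<open>proj1\<close> are
  the two projections of the kernel pair.\<close>

datatype 'a pairs = Base (unbase: 'a) | Pr (proj0: "'a pairs") (proj1: "'a pairs")

definition base_algebra :: "('k, 'a) leibniz \<Rightarrow> ('k, 'a pairs) leibniz" where
  "base_algebra L =
    \<lparr>carrier = Base ` carrier L, monoid.mult = undefined, one = undefined,
     zero = Base \<zero>\<^bsub>L\<^esub>,
     add = (\<lambda>x y. Base (unbase x \<oplus>\<^bsub>L\<^esub> unbase y)),
     smult = (\<lambda>a x. Base (a \<odot>\<^bsub>L\<^esub> unbase x)),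
     bracket = (\<lambda>xs. Base (bracket L (map unbase xs)))\<rparr>"

definition base_arrow :: "('k, 'a) fold_arrow \<Rightarrow> ('k, 'a pairs) fold_arrow" where
  "base_arrow f =
    \<lparr>obj = (\<lambda>I. base_algebra (obj f I)),
     arr = (\<lambda>I J x. Base (arr f I J (unbase x)))\<rparr>"

text \<open>The kernel pair \<open>R[f]\<close> of an \<open>m\<close>-fold arrow \<open>f : B \<rightarrow> A\<close>, where \<open>B\<^sub>I = f\<^sub>I\<close> and
  \<open>A\<^sub>I = f\<^bsub>I \<union> {m}\<^esub>\<close>. It is an \<open>(m - 1)\<close>-fold arrow, i.e. it is only meaningful on
  \<open>I \<subseteq> {1..m - 1}\<close>.\<close>

definition kernel_pair :: "nat \<Rightarrow> ('k, 'a pairs) fold_arrow \<Rightarrow> ('k, 'a pairs) fold_arrow" where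
  "kernel_pair m f =
    \<lparr>obj = (\<lambda>I. let B = obj f I in
       \<lparr>carrier = {Pr x y | x y. x \<in> carrier B \<and> y \<in> carrier B \<and>
                              arr f I (insert m I) x = arr f I (insert m I) y},
        monoid.mult = undefined, one = undefined,
        zero = Pr \<zero>\<^bsub>B\<^esub> \<zero>\<^bsub>B\<^esub>,
        add = (\<lambda>p q. Pr (proj0 p \<oplus>\<^bsub>B\<^esub> proj0 q) (proj1 p \<oplus>\<^bsub>B\<^esub> proj1 q)),
        smult = (\<lambda>a p. Pr (a \<odot>\<^bsub>B\<^esub> proj0 p) (a \<odot>\<^bsub>B\<^esub> proj1 p)),
        bracket = (\<lambda>ps. Pr (bracket B (map proj0 ps)) (bracket B (map proj1 ps)))\<rparr>),
     arr = (\<lambda>I J p. Pr (arr f I J (proj0 p)) (arr f I J (proj1 p)))\<rparr>"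

fun L_pairs ::
    "nat \<Rightarrow> ('k, 'c) ring_scheme \<Rightarrow> nat \<Rightarrow> ('k, 'a pairs) fold_arrow \<Rightarrow> 'a pairs set" where
  "L_pairs n K 0 f = commutator n K (obj f {}) (replicate n (carrier (obj f {})))"
| "L_pairs n K (Suc m) f =
    {k \<in> carrier (obj f {}). Pr \<zero>\<^bsub>obj f {}\<^esub> k \<in> L_pairs n K m (kernel_pair (Suc m) f)}"

definition L_ideal ::
    "nat \<Rightarrow> ('k, 'c) ring_scheme \<Rightarrow> nat \<Rightarrow> ('k, 'a) fold_arrow \<Rightarrow> 'a set" where
  "L_ideal n K m f = {k \<in> carrier (obj f {}). Base k \<in> L_pairs n K m (base_arrow f)}"

text \<open>Centrality of an \<open>m\<close>-fold extension, for \<open>m \<ge> 1\<close>: the two projections of the kernel pair agree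
  on \<open>L\<^bsub>m-1\<^esub>[R[f]]\<close>.\<close>

definition central ::
    "nat \<Rightarrow> ('k, 'c) ring_scheme \<Rightarrow> nat \<Rightarrow> ('k, 'a) fold_arrow \<Rightarrow> bool" where
  "central n K m f \<longleftrightarrow>
    (\<forall>p\<in>L_pairs n K (m - 1) (kernel_pair m (base_arrow f)). proj0 p = proj1 p)"


section \<open>The sum of commutators\<close>

definition covers :: "nat \<Rightarrow> nat \<Rightarrow> nat set list set" where
  "covers n m = {Is. length Is = n \<and> \<Union>(set Is) = {1..m}}"

text \<open>Intersecting with the carrier gives the empty intersection its intended value.\<close>

definition commutator_sum ::
    "nat \<Rightarrow> ('k, 'c) ring_scheme \<Rightarrow> nat \<Rightarrow> ('k, 'a) fold_arrow \<Rightarrow> 'a set" where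
  "commutator_sum n K m f =
    subspace_sum (obj f {}) (covers n m)
      (\<lambda>Is. commutator n K (obj f {})
        (map (\<lambda>I. carrier (obj f {}) \<inter> (\<Inter>i\<in>I. edge_kernel f i)) Is))"

end

theory Submission
  imports Defs
begin

text \<open>
  Let \<open>B = f\<^bsub>{}\<^esub>\<close> and let \<open>N\<^sub>i\<close> be the kernel of \<open>f\<^sub>i\<close>. A bracket in \<open>B\<close> \<^emph>\<open>meets\<close> a set \<open>A\<close> of indices
  if for every \<open>i \<in> A\<close> one of its entries lies in \<open>N\<^sub>i\<close>. Sending an entry \<open>x\<close> to the set of all
  \<open>i \<in> A\<close> with \<open>x \<in> N\<^sub>i\<close> turns such a bracket into a generator of the commutator for a covering of
  \<open>A\<close>, and every generator of every such commutator meets \<open>A\<close>. The order of the entries does not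
  matter for meeting \<open>A\<close>, which takes care of the permutations in the definition of a commutator.

  Let \<open>S A\<close> be the linear span of the brackets that meet \<open>A\<close>. The Leibniz identity makes it an
  ideal (\<open>meeting_span_ideal\<close>), so that the sum of commutators in the claim is just
  \<open>S {1..m}\<close> (\<open>sum_of_commutators_eq_meeting_span\<close>). This replaces ideals generated by brackets,
  which are hard to follow through the recursion for \<open>L\<^sub>m\<close>, by linear spans, which are determined by
  what linear maps do to single brackets.

  It remains to see that \<open>L\<^sub>m[f] = S {1..m}\<close>, by induction on \<open>m\<close>. For \<open>m = 0\<close> both are the
  derived ideal. In the step, let \<open>R = R[f]\<^bsub>{}\<^esub>\<close>, the algebra of pairs \<open>(x, y)\<close> with \<open>y - x \<in> N\<^sub>m\<close>, and
  let \<open>T\<close> be the span of the brackets in \<open>R\<close> that meet \<open>{1..m - 1}\<close>; the induction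
  hypothesis says that \<open>L\<^bsub>m-1\<^esub>[R[f]] = T\<close>. The two are compared in \<open>meeting_span_kernel_pair\<close>:

  \<^item> If \<open>(x, y) \<in> T\<close>, then \<open>y - x \<in> S {1..m}\<close>. For \<open>x\<close> and \<open>y\<close> the two components of one bracket,
    replace the entries of \<open>x\<close> by those of \<open>y\<close> one at a time. Each replacement changes the
    bracket by a bracket with an entry in \<open>N\<^sub>m\<close>, which still meets \<open>{1..m - 1}\<close>.

  \<^item> If \<open>k \<in> S {1..m}\<close>, then \<open>(0, k) \<in> T\<close>. For \<open>k\<close> a bracket, lift its entries \<open>x\<close> to
    \<open>(0, x)\<close> if \<open>x \<in> N\<^sub>m\<close> and to \<open>(x, x)\<close> otherwise. Some lift has first component 0, hence
    so has the bracket of the lifts.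

  Together these give \<open>(0, k) \<in> T\<close> if and only if \<open>k \<in> S {1..m}\<close>, which is the claim for \<open>L\<^sub>m\<close>. The first of
  them also shows that the projections agree on \<open>T\<close> once \<open>S {1..m}\<close> vanishes, and the
  second that they do so only then; this is the criterion for centrality.
\<close>

section \<open>Linear maps and linear spans\<close>

definition linear_map ::
    "('k, 'c) ring_scheme \<Rightarrow> ('k, 'a, 'd) module_scheme \<Rightarrow> ('k, 'b, 'e) module_scheme \<Rightarrow> ('a \<Rightarrow> 'b) \<Rightarrow> bool" where
  "linear_map K L M h \<longleftrightarrow>
    h \<in> carrier L \<rightarrow> carrier M \<and>
    (\<forall>x\<in>carrier L. \<forall>y\<in>carrier L. h (x \<oplus>\<^bsub>L\<^esub> y) = h x \<oplus>\<^bsub>M\<^esub> h y) \<and>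
    (\<forall>a\<in>carrier K. \<forall>x\<in>carrier L. h (a \<odot>\<^bsub>L\<^esub> x) = a \<odot>\<^bsub>M\<^esub> h x)"

lemma leibniz_hom_linear: "h \<in> leibniz_hom n K L M \<Longrightarrow> linear_map K L M h"
  by (simp add: leibniz_hom_def linear_map_def)

definition linear_span ::
    "('k, 'c) ring_scheme \<Rightarrow> ('k, 'a, 'd) module_scheme \<Rightarrow> 'a set \<Rightarrow> 'a set" where
  "linear_span K L G = \<Inter>{N. submodule N K L \<and> G \<subseteq> N}"

lemma (in module) submodule_zero:
  assumes "submodule N R M"
  shows "\<zero>\<^bsub>M\<^esub> \<in> N"
  using subgroup.one_closed[OF submodule.axioms(1)[OF assms]] by simp

lemma (in module) submodule_minus:
  assumes "submodule N R M" "x \<in> N" "y \<in> N"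
  shows "x \<ominus>\<^bsub>M\<^esub> y \<in> N"
  unfolding a_minus_def by (intro submoduleE[OF assms(1)] assms(2,3))

lemma (in module) minus_eq_zero_iff:
  assumes "x \<in> carrier M" "y \<in> carrier M"
  shows "x \<ominus>\<^bsub>M\<^esub> y = \<zero>\<^bsub>M\<^esub> \<longleftrightarrow> x = y"
proof
  assume "x \<ominus>\<^bsub>M\<^esub> y = \<zero>\<^bsub>M\<^esub>"
  then have "\<ominus>\<^bsub>M\<^esub> (\<ominus>\<^bsub>M\<^esub> y) = x"
    using assms by (intro M.minus_equality) (simp_all add: a_minus_def)
  then show "x = y"
    using assms by simp
qed (use assms in \<open>simp add: a_minus_def M.r_neg\<close>)

lemma (in module) a_inv_zero: "\<ominus>\<^bsub>M\<^esub> \<zero>\<^bsub>M\<^esub> = \<zero>\<^bsub>M\<^esub>"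
  by (intro M.minus_equality) simp_all

lemma (in module) minus_zero_right: "x \<in> carrier M \<Longrightarrow> x \<ominus>\<^bsub>M\<^esub> \<zero>\<^bsub>M\<^esub> = x"
  by (simp add: a_minus_def a_inv_zero)

lemma (in module) submodule_finsum:
  assumes N: "submodule N R M" and "x \<in> A \<rightarrow> N"
  shows "(\<Oplus>\<^bsub>M\<^esub>t\<in>A. x t) \<in> N"
  using assms(2)
proof (induction A rule: infinite_finite_induct)
  case (insert t A)
  then have "x \<in> A \<rightarrow> carrier M" "x t \<in> carrier M"
    using submoduleE(1)[OF N] by auto
  then show ?case
    using insert submoduleE(5)[OF N] by (simp add: Pi_iff)
qed (simp_all add: submodule_zero[OF N])

lemma (in module) submodule_Inter:
  assumes "Ns \<noteq> {}" and sub: "\<And>N. N \<in> Ns \<Longrightarrow> submodule N R M"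
  shows "submodule (\<Inter>Ns) R M"
proof (rule submoduleI)
  show "\<Inter>Ns \<subseteq> carrier M"
    using assms submoduleE(1) by blast
  show "\<zero>\<^bsub>M\<^esub> \<in> \<Inter>Ns"
    using submodule_zero[OF sub] by blast
  show "\<ominus>\<^bsub>M\<^esub> a \<in> \<Inter>Ns" if "a \<in> \<Inter>Ns" for a
    using that submoduleE(3)[OF sub] by blast
  show "a \<oplus>\<^bsub>M\<^esub> b \<in> \<Inter>Ns" if "a \<in> \<Inter>Ns" "b \<in> \<Inter>Ns" for a b
    using that submoduleE(5)[OF sub] by blast
  show "a \<odot>\<^bsub>M\<^esub> x \<in> \<Inter>Ns" if "a \<in> carrier R" "x \<in> \<Inter>Ns" for a x
    using that submoduleE(4)[OF sub] by blast
qed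

lemma (in module) linear_map_zero:
  assumes "linear_map R M M' h" and "module R M'"
  shows "h \<zero>\<^bsub>M\<^esub> = \<zero>\<^bsub>M'\<^esub>"
proof -
  interpret M': module R M' by fact
  have "h (\<zero>\<^bsub>M\<^esub> \<oplus>\<^bsub>M\<^esub> \<zero>\<^bsub>M\<^esub>) = h \<zero>\<^bsub>M\<^esub> \<oplus>\<^bsub>M'\<^esub> h \<zero>\<^bsub>M\<^esub>" "h \<zero>\<^bsub>M\<^esub> \<in> carrier M'"
    using assms unfolding linear_map_def by (blast, auto)
  then show ?thesis
    by (simp add: M'.add.l_cancel_one')
qed

lemma (in module) linear_map_minus:
  assumes h: "linear_map R M M' h" and "module R M'"
    and x: "x \<in> carrier M" and y: "y \<in> carrier M"
  shows "h (x \<ominus>\<^bsub>M\<^esub> y) = h x \<ominus>\<^bsub>M'\<^esub> h y"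
proof -
  interpret M': module R M' by fact
  have c: "h x \<in> carrier M'" "h y \<in> carrier M'" "h (\<ominus>\<^bsub>M\<^esub> y) \<in> carrier M'"
    using h x y unfolding linear_map_def by auto
  have "h (\<ominus>\<^bsub>M\<^esub> y) \<oplus>\<^bsub>M'\<^esub> h y = h (\<ominus>\<^bsub>M\<^esub> y \<oplus>\<^bsub>M\<^esub> y)"
    using h y unfolding linear_map_def by (metis M.a_inv_closed)
  also have "\<dots> = \<zero>\<^bsub>M'\<^esub>"
    using linear_map_zero[OF assms(1,2)] y by (simp add: M.l_neg)
  finally have "h (\<ominus>\<^bsub>M\<^esub> y) = \<ominus>\<^bsub>M'\<^esub> h y"
    using M'.minus_equality c by metis
  moreover have "h (x \<oplus>\<^bsub>M\<^esub> \<ominus>\<^bsub>M\<^esub> y) = h x \<oplus>\<^bsub>M'\<^esub> h (\<ominus>\<^bsub>M\<^esub> y)"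
    using h x y unfolding linear_map_def by (metis M.a_inv_closed)
  ultimately show ?thesis
    by (simp add: a_minus_def)
qed

lemma (in module) submodule_preimage:
  assumes h: "linear_map R M M' h" and M': "module R M'" and N: "submodule N R M'"
  shows "submodule {x \<in> carrier M. h x \<in> N} R M"
proof -
  interpret M': module R M' by fact
  show ?thesis
  proof (rule submoduleI)
    fix a assume a: "a \<in> {x \<in> carrier M. h x \<in> N}"
    have "h (\<zero>\<^bsub>M\<^esub> \<ominus>\<^bsub>M\<^esub> a) \<in> N"
      using linear_map_minus[OF h M', of "\<zero>\<^bsub>M\<^esub>" a] a linear_map_zero[OF h M']
        M'.submodule_minus[OF N] M'.submodule_zero[OF N] by auto
    then show "\<ominus>\<^bsub>M\<^esub> a \<in> {x \<in> carrier M. h x \<in> N}"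
      using a by (simp add: a_minus_def)
  next
    show "\<zero>\<^bsub>M\<^esub> \<in> {x \<in> carrier M. h x \<in> N}"
      using M'.submodule_zero[OF N] linear_map_zero[OF h M'] by simp
  next
    show "{x \<in> carrier M. h x \<in> N} \<subseteq> carrier M"
      by blast
    show "a \<oplus>\<^bsub>M\<^esub> b \<in> {x \<in> carrier M. h x \<in> N}"
      if "a \<in> {x \<in> carrier M. h x \<in> N}" "b \<in> {x \<in> carrier M. h x \<in> N}" for a b
      using that h M'.submoduleE(5)[OF N] by (simp add: linear_map_def)
    show "a \<odot>\<^bsub>M\<^esub> x \<in> {x \<in> carrier M. h x \<in> N}"
      if "a \<in> carrier R" "x \<in> {x \<in> carrier M. h x \<in> N}" for a x
      using that h M'.submoduleE(4)[OF N] by (simp add: linear_map_def)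
  qed
qed

lemma (in module) linear_span_superset: "G \<subseteq> linear_span R M G"
  by (auto simp: linear_span_def)

lemma (in module) linear_span_least:
  assumes "submodule N R M" "G \<subseteq> N"
  shows "linear_span R M G \<subseteq> N"
  using assms by (auto simp: linear_span_def)

lemma (in module) linear_span_submodule:
  assumes "G \<subseteq> carrier M"
  shows "submodule (linear_span R M G) R M"
  unfolding linear_span_def by (rule submodule_Inter) (use carrier_is_submodule assms in auto)

text \<open>Membership in a span is transported along linear maps by this principle alone: only the
  generators need to be inspected.\<close>

lemma (in module) linear_map_span:
  assumes h: "linear_map R M M' h" and M': "module R M'" and N: "submodule N R M'"
    and "G \<subseteq> carrier M" and "h ` G \<subseteq> N" and x: "x \<in> linear_span R M G"
  shows "h x \<in> N"
  using linear_span_least[OF submodule_preimage[OF h M' N], of G] assms(4,5) x by blast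

lemma (in module) subspace_sum_submodule:
  assumes T: "finite T" and N: "\<And>t. t \<in> T \<Longrightarrow> submodule (N t) R M"
  shows "submodule (subspace_sum M T N) R M"
proof (rule submoduleI)
  have c: "x \<in> T \<rightarrow> carrier M" if "x \<in> (\<Pi> t\<in>T. N t)" for x
    using that submoduleE(1)[OF N] by blast
  show "subspace_sum M T N \<subseteq> carrier M"
    using c by (auto simp: subspace_sum_def)
  have "(\<Oplus>\<^bsub>M\<^esub>t\<in>T. \<zero>\<^bsub>M\<^esub>) = \<zero>\<^bsub>M\<^esub>"
    by simp
  then show "\<zero>\<^bsub>M\<^esub> \<in> subspace_sum M T N"
    unfolding subspace_sum_def
    using submodule_zero[OF N] by (intro CollectI exI[of _ "\<lambda>_. \<zero>\<^bsub>M\<^esub>"]) auto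
  have smult: "a \<odot>\<^bsub>M\<^esub> x \<in> subspace_sum M T N"
    if a: "a \<in> carrier R" and x: "x \<in> subspace_sum M T N" for a x
  proof -
    obtain u where u: "x = (\<Oplus>\<^bsub>M\<^esub>t\<in>T. u t)" "u \<in> (\<Pi> t\<in>T. N t)"
      using x by (auto simp: subspace_sum_def)
    have "a \<odot>\<^bsub>M\<^esub> x = (\<Oplus>\<^bsub>M\<^esub>t\<in>T. a \<odot>\<^bsub>M\<^esub> u t)"
      using finsum_smult_ldistr[OF T a c[OF u(2)]] u(1) by simp
    moreover have "(\<lambda>t. a \<odot>\<^bsub>M\<^esub> u t) \<in> (\<Pi> t\<in>T. N t)"
      using u(2) a submoduleE(4)[OF N] by auto
    ultimately show ?thesis
      by (auto simp: subspace_sum_def)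
  qed
  then show "a \<odot>\<^bsub>M\<^esub> x \<in> subspace_sum M T N"
    if "a \<in> carrier R" "x \<in> subspace_sum M T N" for a x
    using that by blast
  show "\<ominus>\<^bsub>M\<^esub> x \<in> subspace_sum M T N" if "x \<in> subspace_sum M T N" for x
  proof -
    have "x \<in> carrier M"
      using that c by (auto simp: subspace_sum_def)
    then show ?thesis
      using smult[of "\<ominus> \<one>" x] that smult_l_minus[of \<one> x] by simp
  qed
  show "x \<oplus>\<^bsub>M\<^esub> y \<in> subspace_sum M T N"
    if x: "x \<in> subspace_sum M T N" and y: "y \<in> subspace_sum M T N" for x y
  proof -
    obtain u v where u: "x = (\<Oplus>\<^bsub>M\<^esub>t\<in>T. u t)" "u \<in> (\<Pi> t\<in>T. N t)"
      and v: "y = (\<Oplus>\<^bsub>M\<^esub>t\<in>T. v t)" "v \<in> (\<Pi> t\<in>T. N t)"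
      using x y by (auto simp: subspace_sum_def)
    have "x \<oplus>\<^bsub>M\<^esub> y = (\<Oplus>\<^bsub>M\<^esub>t\<in>T. u t \<oplus>\<^bsub>M\<^esub> v t)"
      using M.finsum_addf[OF c[OF u(2)] c[OF v(2)]] u(1) v(1) by simp
    moreover have "(\<lambda>t. u t \<oplus>\<^bsub>M\<^esub> v t) \<in> (\<Pi> t\<in>T. N t)"
      using u(2) v(2) submoduleE(5)[OF N] by (simp add: Pi_iff)
    ultimately show ?thesis
      by (auto simp: subspace_sum_def)
  qed
qed

lemma (in module) subspace_sum_upper:
  assumes T: "finite T" and N: "\<And>t. t \<in> T \<Longrightarrow> submodule (N t) R M" and s: "s \<in> T"
  shows "N s \<subseteq> subspace_sum M T N"
proof
  fix x assume x: "x \<in> N s"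
  then have xc: "x \<in> carrier M"
    using submoduleE(1)[OF N[OF s]] by auto
  let ?u = "\<lambda>t. if s = t then x else \<zero>\<^bsub>M\<^esub>"
  have "(\<Oplus>\<^bsub>M\<^esub>t\<in>T. ?u t) = x"
    using M.finsum_singleton[OF s T, of "\<lambda>_. x"] xc by simp
  moreover have "?u \<in> (\<Pi> t\<in>T. N t)"
    using x submodule_zero[OF N] by auto
  ultimately show "x \<in> subspace_sum M T N"
    unfolding subspace_sum_def by (intro CollectI exI[of _ ?u]) auto
qed

lemma (in module) subspace_sum_least:
  assumes "submodule S R M" and "\<And>t. t \<in> T \<Longrightarrow> N t \<subseteq> S"
  shows "subspace_sum M T N \<subseteq> S"
proof
  fix y assume "y \<in> subspace_sum M T N"
  then obtain x where "y = (\<Oplus>\<^bsub>M\<^esub>t\<in>T. x t)" "x \<in> (\<Pi> t\<in>T. N t)"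
    by (auto simp: subspace_sum_def)
  then show "y \<in> S"
    using assms(2) submodule_finsum[OF assms(1), of x T] by blast
qed

section \<open>Brackets meeting a family of ideals\<close>

text \<open>The brackets that have, for every \<open>i \<in> A\<close>, an entry in \<open>N i\<close>. One entry may serve several
  indices, just as the members of a covering may overlap.\<close>

definition meeting_brackets ::
    "nat \<Rightarrow> ('k, 'a, 'd) leibniz_scheme \<Rightarrow> ('i \<Rightarrow> 'a set) \<Rightarrow> 'i set \<Rightarrow> 'a set" where
  "meeting_brackets n L N A =
    {bracket L xs | xs. length xs = n \<and> set xs \<subseteq> carrier L \<and> (\<forall>i\<in>A. \<exists>x\<in>set xs. x \<in> N i)}"

definition meeting_span ::
    "nat \<Rightarrow> ('k, 'c) ring_scheme \<Rightarrow> ('k, 'a, 'd) leibniz_scheme \<Rightarrow> ('i \<Rightarrow> 'a set) \<Rightarrow> 'i set \<Rightarrow> 'a set" where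
  "meeting_span n K L N A = linear_span K L (meeting_brackets n L N A)"

lemma set_list_update_subset: "set xs \<subseteq> C \<Longrightarrow> x \<in> C \<Longrightarrow> set (xs[i := x]) \<subseteq> C"
  using set_update_subset_insert[of xs i x] by blast

context leibniz_algebra
begin

lemma module_L: "module K L" ..

lemma bracket_linear:
  assumes "length xs = n" "set xs \<subseteq> carrier L" "i < n"
  shows "linear_map K L L (\<lambda>x. bracket L (xs[i := x]))"
  using assms unfolding linear_map_def
  by (simp add: bracket_add bracket_smult bracket_closed set_list_update_subset)

lemma bracket_zero:
  assumes xs: "length xs = n" "set xs \<subseteq> carrier L" and "\<zero>\<^bsub>L\<^esub> \<in> set xs"
  shows "bracket L xs = \<zero>\<^bsub>L\<^esub>"
proof -
  obtain i where "i < n" "xs ! i = \<zero>\<^bsub>L\<^esub>"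
    using assms by (metis in_set_conv_nth)
  then show ?thesis
    using linear_map_zero[OF bracket_linear[OF xs \<open>i < n\<close>] module_L] list_update_id[of xs i] by simp
qed

lemma meeting_brackets_carrier: "meeting_brackets n L N A \<subseteq> carrier L"
  by (auto simp: meeting_brackets_def bracket_closed)

lemma meeting_span_submodule: "submodule (meeting_span n K L N A) K L"
  unfolding meeting_span_def by (intro linear_span_submodule meeting_brackets_carrier)

lemma meeting_span_bracket:
  assumes "length xs = n" "set xs \<subseteq> carrier L" "\<And>i. i \<in> A \<Longrightarrow> \<exists>x\<in>set xs. x \<in> N i"
  shows "bracket L xs \<in> meeting_span n K L N A"
  unfolding meeting_span_def
  by (rule subsetD[OF linear_span_superset]) (use assms in \<open>auto simp: meeting_brackets_def\<close>)

text \<open>Write \<open>xs = x # ys\<close> and expand \<open>[[\<dots>, x, \<dots>], ys]\<close>, with \<open>x\<close> in position \<open>p\<close> of \<open>zs\<close>, by the Leibniz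
  identity. Its term at \<open>p\<close> is the nested bracket in question. Every other term of the
  identity meets \<open>A\<close>: an index that \<open>xs\<close> meets in \<open>x\<close> is met by \<open>x\<close>, or by the inner bracket containing \<open>x\<close>, and one
  that it meets in \<open>ys\<close> is met by \<open>ys\<close> on the left-hand side and by the entry \<open>[z\<^sub>j, ys]\<close> in the \<open>j\<close>-th
  term. Both use that the \<open>N i\<close> are ideals.\<close>

lemma nested_bracket_in_meeting_span:
  assumes N: "\<And>i. i \<in> A \<Longrightarrow> leibniz_ideal n K L (N i)"
    and xs: "length xs = n" "set xs \<subseteq> carrier L" "\<And>i. i \<in> A \<Longrightarrow> \<exists>x\<in>set xs. x \<in> N i"
    and zs: "length zs = n" "set zs \<subseteq> carrier L" and p: "p < n"
  shows "bracket L (zs[p := bracket L xs]) \<in> meeting_span n K L N A" (is "_ \<in> ?S")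
proof -
  obtain x ys where eq: "xs = x # ys"
    using xs(1) p by (cases xs) auto
  have ys: "length ys = n - 1" "set ys \<subseteq> carrier L" and x: "x \<in> carrier L"
    using xs eq by auto
  \<comment> \<open>Both sides of the identity now start from \<open>ws\<close>, with \<open>x\<close> put in the place of the nested bracket.\<close>
  define ws where "ws = zs[p := x]"
  have ws: "length ws = n" "set ws \<subseteq> carrier L" "ws ! p = x"
    using zs x p by (simp_all add: ws_def set_list_update_subset)
  have bc: "bracket L (w # ys) \<in> carrier L" if "w \<in> carrier L" for w
    using that ys p by (intro bracket_closed) auto
  have wc: "ws ! j \<in> carrier L" if "j < n" for j
    using ws that by (metis nth_mem subsetD)
  define t where "t j = bracket L (ws[j := bracket L (ws ! j # ys)])" for j
  have bid: "bracket L us \<in> N i"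
    if "i \<in> A" "length us = n" "set us \<subseteq> carrier L" "u \<in> set us" "u \<in> N i" for i us u
    using N[OF that(1)] that unfolding leibniz_ideal_def by blast
  have hit: "x \<in> N i \<or> (\<exists>y\<in>set ys. y \<in> N i)" if "i \<in> A" for i
    using xs(3)[OF that] eq by auto
  have S: "submodule ?S K L"
    by (rule meeting_span_submodule)
  have lhs: "bracket L (bracket L ws # ys) \<in> ?S"
  proof (rule meeting_span_bracket)
    fix i assume i: "i \<in> A"
    have "x \<in> set ws"
      using ws p by (metis nth_mem)
    then show "\<exists>u\<in>set (bracket L ws # ys). u \<in> N i"
      using hit[OF i] bid[OF i ws(1,2)] by auto
  qed (use ys p ws in \<open>auto intro: bracket_closed\<close>)
  have t: "t j \<in> ?S" if j: "j < n" "j \<noteq> p" for j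
    unfolding t_def
  proof (rule meeting_span_bracket)
    let ?us = "ws[j := bracket L (ws ! j # ys)]"
    fix i assume i: "i \<in> A"
    have "?us ! p = x" "?us ! j = bracket L (ws ! j # ys)"
      using j ws by auto
    then have "x \<in> set ?us" "bracket L (ws ! j # ys) \<in> set ?us"
      using j p ws(1) by (metis length_list_update nth_mem)+
    moreover have "bracket L (ws ! j # ys) \<in> N i" if "y \<in> set ys" "y \<in> N i" for y
      using that i ys wc[OF j(1)] p by (intro bid[of i _ y]) auto
    ultimately show "\<exists>u\<in>set ?us. u \<in> N i"
      using hit[OF i] by blast
  qed (use ws bc wc j in \<open>simp_all add: set_list_update_subset\<close>)
  have tc: "t \<in> ({..<n} - {p}) \<rightarrow> carrier L" "t p \<in> carrier L"
    unfolding t_def using ws bc wc p bc[OF x]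
    by (simp_all add: bracket_closed set_list_update_subset)
  have rest: "(\<Oplus>\<^bsub>L\<^esub>j\<in>{..<n} - {p}. t j) \<in> ?S"
    using t by (intro submodule_finsum[OF S]) auto
  then have rest_carrier: "(\<Oplus>\<^bsub>L\<^esub>j\<in>{..<n} - {p}. t j) \<in> carrier L"
    using submoduleE(1)[OF S] by blast
  have "bracket L (bracket L ws # ys) = (\<Oplus>\<^bsub>L\<^esub>j\<in>{..<n}. t j)"
    unfolding t_def using leibniz_identity[OF ws(1,2) ys] .
  also have "{..<n} = insert p ({..<n} - {p})"
    using p by auto
  also have "(\<Oplus>\<^bsub>L\<^esub>j\<in>insert p ({..<n} - {p}). t j) = t p \<oplus>\<^bsub>L\<^esub> (\<Oplus>\<^bsub>L\<^esub>j\<in>{..<n} - {p}. t j)"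
    using tc by (intro M.finsum_insert) auto
  finally have "t p = bracket L (bracket L ws # ys) \<ominus>\<^bsub>L\<^esub> (\<Oplus>\<^bsub>L\<^esub>j\<in>{..<n} - {p}. t j)"
    using tc(2) rest_carrier by (simp add: a_minus_def M.a_assoc M.r_neg)
  then have "t p \<in> ?S"
    using submodule_minus[OF S lhs rest] by simp
  moreover have "t p = bracket L (zs[p := bracket L xs])"
    using ws(3) by (simp add: t_def ws_def eq)
  ultimately show ?thesis
    by simp
qed

lemma meeting_span_ideal:
  assumes N: "\<And>i. i \<in> A \<Longrightarrow> leibniz_ideal n K L (N i)"
  shows "leibniz_ideal n K L (meeting_span n K L N A)"
  unfolding leibniz_ideal_def
proof (intro conjI allI impI)
  fix zs assume zs: "length zs = n \<and> set zs \<subseteq> carrier L \<and> (\<exists>x\<in>set zs. x \<in> meeting_span n K L N A)"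
  then obtain p where p: "p < n" "zs ! p \<in> meeting_span n K L N A"
    by (metis in_set_conv_nth)
  have "bracket L (zs[p := zs ! p]) \<in> meeting_span n K L N A"
    using p zs
  proof (intro linear_map_span[OF bracket_linear module_L meeting_span_submodule meeting_brackets_carrier])
    show "(\<lambda>x. bracket L (zs[p := x])) ` meeting_brackets n L N A \<subseteq> meeting_span n K L N A"
    proof (intro image_subsetI)
      fix x assume "x \<in> meeting_brackets n L N A"
      then obtain xs where "x = bracket L xs" "length xs = n" "set xs \<subseteq> carrier L"
        "\<forall>i\<in>A. \<exists>x\<in>set xs. x \<in> N i"
        unfolding meeting_brackets_def by blast
      then show "bracket L (zs[p := x]) \<in> meeting_span n K L N A"
        using nested_bracket_in_meeting_span[of A N xs zs p] N p zs by blast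
    qed
  qed (auto simp: meeting_span_def)
  then show "bracket L zs \<in> meeting_span n K L N A"
    by simp
qed (rule meeting_span_submodule)

text \<open>The entries of \<open>xs\<close> are replaced by those of \<open>ys\<close> from left to right. By linearity the
  replacement at \<open>p\<close> adds a bracket with \<open>y\<^sub>p - x\<^sub>p \<in> N m\<close> at position \<open>p\<close>. An index \<open>i \<in> A\<close> is met in each of
  these brackets at the position \<open>j\<close> supplied by the last hypothesis, whose entry is
  \<open>x\<^sub>j\<close>, \<open>y\<^sub>j\<close> or \<open>y\<^sub>j - x\<^sub>j\<close>.\<close>

lemma bracket_difference_in_meeting_span:
  assumes xs: "length xs = n" "set xs \<subseteq> carrier L" and ys: "length ys = n" "set ys \<subseteq> carrier L"
    and N: "\<And>i. i \<in> A \<Longrightarrow> submodule (N i) K L"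
    and diff: "\<And>j. j < n \<Longrightarrow> ys ! j \<ominus>\<^bsub>L\<^esub> xs ! j \<in> N m"
    and hit: "\<And>i. i \<in> A \<Longrightarrow> \<exists>j<n. xs ! j \<in> N i \<and> ys ! j \<in> N i"
  shows "bracket L ys \<ominus>\<^bsub>L\<^esub> bracket L xs \<in> meeting_span n K L N (insert m A)" (is "_ \<in> ?S")
proof -
  have S: "submodule ?S K L"
    by (rule meeting_span_submodule)
  have "bracket L (take p ys @ drop p xs) \<ominus>\<^bsub>L\<^esub> bracket L xs \<in> ?S" if "p \<le> n" for p
    using that
  proof (induction p)
    case 0
    show ?case
      using bracket_closed[OF xs] submodule_zero[OF S] by (simp add: a_minus_def M.r_neg)
  next
    case (Suc p)
    define zs where "zs = take p ys @ drop p xs"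
    have zs: "length zs = n" "set zs \<subseteq> carrier L" "zs ! p = xs ! p" and p: "p < n"
      using Suc.prems xs ys by (auto simp: zs_def nth_append dest: in_set_takeD in_set_dropD)
    have next_zs: "take (Suc p) ys @ drop (Suc p) xs = zs[p := ys ! p]"
      using p xs(1) ys(1)
      by (simp add: zs_def list_update_append take_Suc_conv_app_nth Cons_nth_drop_Suc[symmetric])
    have c: "xs ! p \<in> carrier L" "ys ! p \<in> carrier L"
      using p xs ys by auto
    let ?d = "ys ! p \<ominus>\<^bsub>L\<^esub> xs ! p"
    have step: "bracket L (zs[p := ?d]) \<in> ?S"
    proof (rule meeting_span_bracket)
      fix i assume "i \<in> insert m A"
      then consider "i = m" | "i \<in> A" by auto
      then show "\<exists>x\<in>set (zs[p := ?d]). x \<in> N i"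
      proof cases
        case 1
        then show ?thesis
          using diff[OF p] p zs(1) by (auto intro!: bexI[of _ ?d] set_update_memI)
      next
        case 2
        obtain j where j: "j < n" "xs ! j \<in> N i" "ys ! j \<in> N i"
          using hit[OF 2] by auto
        then have "zs[p := ?d] ! j \<in> N i"
          using zs(1) p xs(1) ys(1) submodule_minus[OF N[OF 2]]
          by (auto simp: nth_list_update zs_def nth_append)
        then show ?thesis
          using j(1) zs(1) by (metis length_list_update nth_mem)
      qed
    qed (use zs c in \<open>simp_all add: set_list_update_subset\<close>)
    have "bracket L (zs[p := ?d]) = bracket L (zs[p := ys ! p]) \<ominus>\<^bsub>L\<^esub> bracket L zs"
      using linear_map_minus[OF bracket_linear[OF zs(1,2) p] module_L c(2,1)]
      by (metis zs(3) list_update_id)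
    moreover have "bracket L (zs[p := ys ! p]) \<in> carrier L" "bracket L zs \<in> carrier L"
      "bracket L xs \<in> carrier L"
      using zs xs c by (simp_all add: bracket_closed set_list_update_subset)
    ultimately have "bracket L (zs[p := ys ! p]) \<ominus>\<^bsub>L\<^esub> bracket L xs =
        bracket L (zs[p := ?d]) \<oplus>\<^bsub>L\<^esub> (bracket L zs \<ominus>\<^bsub>L\<^esub> bracket L xs)"
      by (simp add: a_minus_def M.a_assoc M.r_neg1)
    moreover have "bracket L zs \<ominus>\<^bsub>L\<^esub> bracket L xs \<in> ?S"
      using Suc by (simp add: zs_def)
    ultimately show ?case
      using next_zs submoduleE(5)[OF S step] by metis
  qed
  from this[of n] show ?thesis
    using xs(1) ys(1) by simp
qed


lemma carrier_ideal: "leibniz_ideal n K L (carrier L)"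
  unfolding leibniz_ideal_def using carrier_is_submodule bracket_closed by blast

lemma commutator_submodule:
  assumes Ns: "\<And>N. N \<in> set Ns \<Longrightarrow> N \<subseteq> carrier L" and "length Ns = n"
  shows "submodule (commutator n K L Ns) K L"
  unfolding commutator_def leibniz_genideal_def
proof (rule submodule_Inter)
  have "bracket L xs \<in> carrier L" if "mset ys = mset xs" "list_all2 (\<in>) ys Ns" for xs ys
  proof (rule bracket_closed)
    show "length xs = n"
      using that assms(2) by (metis list_all2_lengthD size_mset)
    have "set ys \<subseteq> carrier L"
      using that(2) Ns by (fastforce simp: list_all2_conv_all_nth in_set_conv_nth)
    then show "set xs \<subseteq> carrier L"
      using mset_eq_setD[OF that(1)] by simp
  qed
  then show "{N. leibniz_ideal n K L N \<and>
      {bracket L xs | xs. \<exists>ys. mset ys = mset xs \<and> list_all2 (\<in>) ys Ns} \<subseteq> N} \<noteq> {}"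
    using carrier_ideal by blast
qed (auto simp: leibniz_ideal_def)

lemma bracket_in_commutator:
  assumes "list_all2 (\<in>) xs Ns"
  shows "bracket L xs \<in> commutator n K L Ns"
  unfolding commutator_def leibniz_genideal_def using assms by blast

lemma commutator_least:
  assumes "leibniz_ideal n K L I"
    and "\<And>xs ys. mset ys = mset xs \<Longrightarrow> list_all2 (\<in>) ys Ns \<Longrightarrow> bracket L xs \<in> I"
  shows "commutator n K L Ns \<subseteq> I"
  unfolding commutator_def leibniz_genideal_def using assms by blast

text \<open>Every bracket meets the empty set of indices. This is the start of the recursion for \<open>L\<^sub>m\<close>.\<close>

lemma derived_ideal_eq_meeting_span:
  "commutator n K L (replicate n (carrier L)) = meeting_span n K L N {}"
proof
  show "commutator n K L (replicate n (carrier L)) \<subseteq> meeting_span n K L N {}"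
  proof (rule commutator_least[OF meeting_span_ideal])
    fix xs ys assume *: "mset ys = mset xs" "list_all2 (\<in>) ys (replicate n (carrier L))"
    then have "length xs = n" "set ys \<subseteq> carrier L"
      by (metis list_all2_lengthD length_replicate size_mset)
        (use * in \<open>fastforce simp: list_all2_conv_all_nth in_set_conv_nth\<close>)
    then show "bracket L xs \<in> meeting_span n K L N {}"
      using mset_eq_setD[OF *(1)] by (intro meeting_span_bracket) auto
  qed simp
  show "meeting_span n K L N {} \<subseteq> commutator n K L (replicate n (carrier L))"
    unfolding meeting_span_def
  proof (rule linear_span_least)
    show "meeting_brackets n L N {} \<subseteq> commutator n K L (replicate n (carrier L))"
      by (fastforce simp: meeting_brackets_def list_all2_conv_all_nth intro!: bracket_in_commutator)
  qed (auto intro: commutator_submodule)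
qed

text \<open>A generator of a commutator on the left meets \<open>A\<close>, and \<open>meeting_span n K L N A\<close> is an ideal, so it
  contains the generated ideals. Conversely a bracket that meets \<open>A\<close> exhibits a covering of \<open>A\<close>.\<close>

lemma sum_of_commutators_eq_meeting_span:
  assumes A: "finite A" and N: "\<And>i. i \<in> A \<Longrightarrow> leibniz_ideal n K L (N i)"
  shows "subspace_sum L {Is. length Is = n \<and> \<Union>(set Is) = A}
      (\<lambda>Is. commutator n K L (map (\<lambda>I. carrier L \<inter> (\<Inter>i\<in>I. N i)) Is)) = meeting_span n K L N A"
    (is "subspace_sum L ?T ?C = _")
proof
  show "subspace_sum L ?T ?C \<subseteq> meeting_span n K L N A"
  proof (intro subspace_sum_least meeting_span_submodule commutator_least meeting_span_ideal N)
    fix Is xs ys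
    assume Is: "Is \<in> ?T" and *: "mset ys = mset xs"
      and mem: "list_all2 (\<in>) ys (map (\<lambda>I. carrier L \<inter> (\<Inter>i\<in>I. N i)) Is)"
    have len: "length ys = length Is" "length xs = n"
      using Is mem * by (auto dest!: list_all2_lengthD mset_eq_length)
    have nth: "ys ! j \<in> carrier L" "i \<in> Is ! j \<Longrightarrow> ys ! j \<in> N i" if "j < length Is" for i j
      using mem that len by (auto simp: list_all2_conv_all_nth)
    show "bracket L xs \<in> meeting_span n K L N A"
    proof (rule meeting_span_bracket)
      show "set xs \<subseteq> carrier L"
        using nth(1) len mset_eq_setD[OF *] by (metis in_set_conv_nth subsetI)
      fix i assume "i \<in> A"
      then have "i \<in> \<Union>(set Is)"
        using Is by blast
      then obtain j where "j < length Is" "i \<in> Is ! j"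
        by (metis UnionE in_set_conv_nth)
      then show "\<exists>x\<in>set xs. x \<in> N i"
        using nth(2) len(1) mset_eq_setD[OF *] by (metis nth_mem)
    qed (rule len(2))
  qed
  have "?T \<subseteq> {Is. set Is \<subseteq> Pow A \<and> length Is = n}"
    by auto
  then have T: "finite ?T"
    using finite_lists_length_eq[of "Pow A" n] A finite_subset by blast
  have C: "submodule (?C Is) K L" if "Is \<in> ?T" for Is
    using that by (intro commutator_submodule) auto
  show "meeting_span n K L N A \<subseteq> subspace_sum L ?T ?C"
    unfolding meeting_span_def
  proof (rule linear_span_least[OF subspace_sum_submodule[OF T C]])
    show "meeting_brackets n L N A \<subseteq> subspace_sum L ?T ?C"
    proof
      fix b assume "b \<in> meeting_brackets n L N A"
      then obtain xs where xs: "b = bracket L xs" "length xs = n" "set xs \<subseteq> carrier L"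
        "\<And>i. i \<in> A \<Longrightarrow> \<exists>x\<in>set xs. x \<in> N i"
        unfolding meeting_brackets_def by blast
      \<comment> \<open>The finest information about \<open>xs\<close>: its \<open>j\<close>-th entry is assigned all indices that it meets.\<close>
      let ?Is = "map (\<lambda>x. {i \<in> A. x \<in> N i}) xs"
      have Is: "?Is \<in> ?T"
        using xs by auto
      have "b \<in> ?C ?Is"
        unfolding xs(1) by (rule bracket_in_commutator) (use xs in \<open>auto simp: list_all2_conv_all_nth\<close>)
      then show "b \<in> subspace_sum L ?T ?C"
        using subspace_sum_upper[of ?T ?C ?Is, OF T C Is] by blast
    qed
  qed auto
qed

end

section \<open>Algebras of pairs\<close>

text \<open>All axioms except closure and the existence of negatives are equations, and these can be checked
  after applying a jointly injective family of homomorphisms. This applies to the two projections of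
  a kernel pair and to the inverse of \<open>Base\<close>.\<close>

lemma leibniz_algebra_jointly_injective:
  fixes L :: "('k, 'a, 'd) leibniz_scheme" and M :: "('k, 'b, 'e) leibniz_scheme"
    and h :: "'s \<Rightarrow> 'a \<Rightarrow> 'b"
  assumes "leibniz_algebra n K M" and n: "n > 0"
    and inj: "\<And>x y. \<lbrakk>x \<in> carrier L; y \<in> carrier L; \<And>s. s \<in> S \<Longrightarrow> h s x = h s y\<rbrakk> \<Longrightarrow> x = y"
    and closed: "\<And>s x. \<lbrakk>s \<in> S; x \<in> carrier L\<rbrakk> \<Longrightarrow> h s x \<in> carrier M"
    and zero: "\<zero>\<^bsub>L\<^esub> \<in> carrier L" "\<And>s. s \<in> S \<Longrightarrow> h s \<zero>\<^bsub>L\<^esub> = \<zero>\<^bsub>M\<^esub>"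
    and add: "\<And>x y. \<lbrakk>x \<in> carrier L; y \<in> carrier L\<rbrakk> \<Longrightarrow> x \<oplus>\<^bsub>L\<^esub> y \<in> carrier L"
      "\<And>s x y. \<lbrakk>s \<in> S; x \<in> carrier L; y \<in> carrier L\<rbrakk> \<Longrightarrow> h s (x \<oplus>\<^bsub>L\<^esub> y) = h s x \<oplus>\<^bsub>M\<^esub> h s y"
    and neg: "\<And>x. x \<in> carrier L \<Longrightarrow> \<exists>y\<in>carrier L. \<forall>s\<in>S. h s y = \<ominus>\<^bsub>M\<^esub> h s x"
    and smult: "\<And>a x. \<lbrakk>a \<in> carrier K; x \<in> carrier L\<rbrakk> \<Longrightarrow> a \<odot>\<^bsub>L\<^esub> x \<in> carrier L"
      "\<And>s a x. \<lbrakk>s \<in> S; a \<in> carrier K; x \<in> carrier L\<rbrakk> \<Longrightarrow> h s (a \<odot>\<^bsub>L\<^esub> x) = a \<odot>\<^bsub>M\<^esub> h s x"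
    and bracket: "\<And>xs. \<lbrakk>length xs = n; set xs \<subseteq> carrier L\<rbrakk> \<Longrightarrow> bracket L xs \<in> carrier L"
      "\<And>s xs. \<lbrakk>s \<in> S; length xs = n; set xs \<subseteq> carrier L\<rbrakk> \<Longrightarrow>
        h s (bracket L xs) = bracket M (map (h s) xs)"
  shows "leibniz_algebra n K L"
proof -
  interpret M: leibniz_algebra n K M by fact
  interpret L: abelian_group L
  proof (rule abelian_groupI)
    show "\<exists>y\<in>carrier L. y \<oplus>\<^bsub>L\<^esub> x = \<zero>\<^bsub>L\<^esub>" if x: "x \<in> carrier L" for x
    proof -
      obtain y where "y \<in> carrier L" "\<forall>s\<in>S. h s y = \<ominus>\<^bsub>M\<^esub> h s x"
        using neg[OF x] by blast
      then show ?thesis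
        using x by (intro bexI[of _ y] inj) (simp_all add: add zero closed M.M.l_neg)
    qed
    show "x \<oplus>\<^bsub>L\<^esub> y \<oplus>\<^bsub>L\<^esub> z = x \<oplus>\<^bsub>L\<^esub> (y \<oplus>\<^bsub>L\<^esub> z)"
      if "x \<in> carrier L" "y \<in> carrier L" "z \<in> carrier L" for x y z
      using that by (intro inj) (simp_all add: add closed M.M.a_assoc)
    show "x \<oplus>\<^bsub>L\<^esub> y = y \<oplus>\<^bsub>L\<^esub> x" if "x \<in> carrier L" "y \<in> carrier L" for x y
      using that by (intro inj) (simp_all add: add closed M.M.a_comm)
    show "\<zero>\<^bsub>L\<^esub> \<oplus>\<^bsub>L\<^esub> x = x" if "x \<in> carrier L" for x
      using that by (intro inj) (simp_all add: add zero closed)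
  qed (fact zero add)+
  interpret L: module K L
  proof (rule moduleI)
    show "cring K" ..
    show "abelian_group L" ..
    show "(a \<oplus>\<^bsub>K\<^esub> b) \<odot>\<^bsub>L\<^esub> x = a \<odot>\<^bsub>L\<^esub> x \<oplus>\<^bsub>L\<^esub> b \<odot>\<^bsub>L\<^esub> x"
      if "a \<in> carrier K" "b \<in> carrier K" "x \<in> carrier L" for a b x
      using that by (intro inj) (simp_all add: add smult closed M.smult_l_distr)
    show "a \<odot>\<^bsub>L\<^esub> (x \<oplus>\<^bsub>L\<^esub> y) = a \<odot>\<^bsub>L\<^esub> x \<oplus>\<^bsub>L\<^esub> a \<odot>\<^bsub>L\<^esub> y"
      if "a \<in> carrier K" "x \<in> carrier L" "y \<in> carrier L" for a x y
      using that by (intro inj) (simp_all add: add smult closed M.smult_r_distr)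
    show "(a \<otimes>\<^bsub>K\<^esub> b) \<odot>\<^bsub>L\<^esub> x = a \<odot>\<^bsub>L\<^esub> (b \<odot>\<^bsub>L\<^esub> x)"
      if "a \<in> carrier K" "b \<in> carrier K" "x \<in> carrier L" for a b x
      using that by (intro inj) (simp_all add: smult closed M.smult_assoc1)
    show "\<one>\<^bsub>K\<^esub> \<odot>\<^bsub>L\<^esub> x = x" if "x \<in> carrier L" for x
      using that by (intro inj) (simp_all add: smult closed)
  qed (fact smult)
  have finsum: "h s (\<Oplus>\<^bsub>L\<^esub>i\<in>A. t i) = (\<Oplus>\<^bsub>M\<^esub>i\<in>A. h s (t i))"
    if s: "s \<in> S" and t: "t \<in> A \<rightarrow> carrier L" for s t and A :: "nat set"
    using t
  proof (induction A rule: infinite_finite_induct)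
    case (insert i A)
    then have "t \<in> A \<rightarrow> carrier L" "t i \<in> carrier L" "(\<lambda>i. h s (t i)) \<in> A \<rightarrow> carrier M"
      using closed s by auto
    then show ?case
      using insert s by (simp add: add closed)
  qed (use s in \<open>simp_all add: zero\<close>)
  have map_closed: "set (map (h s) xs) \<subseteq> carrier M" if "s \<in> S" "set xs \<subseteq> carrier L" for s xs
    using that closed by auto
  show ?thesis
  proof unfold_locales
    fix xs assume xs: "length xs = n" "set xs \<subseteq> carrier L"
    show "bracket L xs \<in> carrier L"
      by (rule bracket(1)[OF xs])
  next
    fix xs i x y
    assume "length xs = n" "set xs \<subseteq> carrier L" "i < n" "x \<in> carrier L" "y \<in> carrier L"
    then show "bracket L (xs[i := x \<oplus>\<^bsub>L\<^esub> y]) = bracket L (xs[i := x]) \<oplus>\<^bsub>L\<^esub> bracket L (xs[i := y])"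
      by (intro inj) (simp_all add: add bracket set_list_update_subset map_update M.bracket_add
          map_closed closed del: set_map)
  next
    fix xs i a x
    assume "length xs = n" "set xs \<subseteq> carrier L" "i < n" "a \<in> carrier K" "x \<in> carrier L"
    then show "bracket L (xs[i := a \<odot>\<^bsub>L\<^esub> x]) = a \<odot>\<^bsub>L\<^esub> bracket L (xs[i := x])"
      by (intro inj) (simp_all add: smult bracket set_list_update_subset map_update M.bracket_smult
          map_closed closed del: set_map)
  next
    fix xs ys
    assume xs: "length xs = n" "set xs \<subseteq> carrier L" and ys: "length ys = n - 1" "set ys \<subseteq> carrier L"
    have inner: "length (xs ! i # ys) = n" "set (xs ! i # ys) \<subseteq> carrier L" if "i < n" for i
      using xs ys that n by auto
    let ?t = "\<lambda>i. xs[i := bracket L (xs ! i # ys)]"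
    have t: "length (?t i) = n" "set (?t i) \<subseteq> carrier L" if "i < n" for i
      using xs bracket(1)[OF inner[OF that]] by (simp_all add: set_list_update_subset)
    have outer: "length (bracket L xs # ys) = n" "set (bracket L xs # ys) \<subseteq> carrier L"
      using xs ys n bracket(1)[OF xs] by simp_all
    show "bracket L (bracket L xs # ys) = (\<Oplus>\<^bsub>L\<^esub>i\<in>{..<n}. bracket L (?t i))"
    proof (rule inj)
      show "(\<Oplus>\<^bsub>L\<^esub>i\<in>{..<n}. bracket L (?t i)) \<in> carrier L"
        using bracket(1)[OF t] by (intro L.finsum_closed) simp
      fix s assume s: "s \<in> S"
      have "h s (bracket L (bracket L xs # ys)) =
          bracket M (bracket M (map (h s) xs) # map (h s) ys)"
        using bracket(2)[OF s outer] bracket(2)[OF s xs] by simp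
      also have "\<dots> = (\<Oplus>\<^bsub>M\<^esub>i\<in>{..<n}.
          bracket M ((map (h s) xs)[i := bracket M (map (h s) xs ! i # map (h s) ys)]))"
        using M.leibniz_identity[of "map (h s) xs" "map (h s) ys"] xs ys
          map_closed[OF s xs(2)] map_closed[OF s ys(2)] by simp
      also have "\<dots> = (\<Oplus>\<^bsub>M\<^esub>i\<in>{..<n}. h s (bracket L (?t i)))"
        using bracket(2)[OF s t] bracket(2)[OF s inner] xs(1) closed[OF s bracket(1)[OF t]]
        by (intro M.finsum_cong') (simp_all add: map_update Pi_iff)
      also have "\<dots> = h s (\<Oplus>\<^bsub>L\<^esub>i\<in>{..<n}. bracket L (?t i))"
        using bracket(1)[OF t] by (intro finsum[symmetric] s) simp
      finally show "h s (bracket L (bracket L xs # ys)) =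
          h s (\<Oplus>\<^bsub>L\<^esub>i\<in>{..<n}. bracket L (?t i))" .
    qed (rule bracket(1)[OF outer])
  qed
qed

text \<open>With a single constant ideal, this turns \<open>bracket_difference_in_meeting_span\<close> into the statement
  that the bracket respects congruence modulo an ideal.\<close>

lemma (in leibniz_algebra) meeting_span_subset_ideal:
  assumes "i \<in> A" and N: "leibniz_ideal n K L (N i)"
  shows "meeting_span n K L N A \<subseteq> N i"
  unfolding meeting_span_def
proof (rule linear_span_least)
  show "submodule (N i) K L"
    using N by (simp add: leibniz_ideal_def)
  show "meeting_brackets n L N A \<subseteq> N i"
    using assms unfolding meeting_brackets_def leibniz_ideal_def by blast
qed

text \<open>The object of the kernel pair at the empty set, with the condition that the two components have
  the same image expressed by the kernel \<open>N\<close>. The iterated kernel pair then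
  depends only on the ideals \<open>edge_kernel f i\<close> of \<open>f\<^bsub>{}\<^esub>\<close>.\<close>

definition kernel_pair_algebra ::
    "('k, 'a pairs) leibniz \<Rightarrow> 'a pairs set \<Rightarrow> ('k, 'a pairs) leibniz" where
  "kernel_pair_algebra B N =
    \<lparr>carrier = {Pr x y | x y. x \<in> carrier B \<and> y \<in> carrier B \<and> y \<ominus>\<^bsub>B\<^esub> x \<in> N},
     monoid.mult = undefined, one = undefined,
     zero = Pr \<zero>\<^bsub>B\<^esub> \<zero>\<^bsub>B\<^esub>,
     add = (\<lambda>p q. Pr (proj0 p \<oplus>\<^bsub>B\<^esub> proj0 q) (proj1 p \<oplus>\<^bsub>B\<^esub> proj1 q)),
     smult = (\<lambda>a p. Pr (a \<odot>\<^bsub>B\<^esub> proj0 p) (a \<odot>\<^bsub>B\<^esub> proj1 p)),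
     bracket = (\<lambda>ps. Pr (bracket B (map proj0 ps)) (bracket B (map proj1 ps)))\<rparr>"

lemma kernel_pair_algebra_simps:
  "p \<in> carrier (kernel_pair_algebra B N) \<longleftrightarrow>
    (\<exists>x y. p = Pr x y \<and> x \<in> carrier B \<and> y \<in> carrier B \<and> y \<ominus>\<^bsub>B\<^esub> x \<in> N)"
  "\<zero>\<^bsub>kernel_pair_algebra B N\<^esub> = Pr \<zero>\<^bsub>B\<^esub> \<zero>\<^bsub>B\<^esub>"
  "p \<oplus>\<^bsub>kernel_pair_algebra B N\<^esub> q = Pr (proj0 p \<oplus>\<^bsub>B\<^esub> proj0 q) (proj1 p \<oplus>\<^bsub>B\<^esub> proj1 q)"
  "a \<odot>\<^bsub>kernel_pair_algebra B N\<^esub> p = Pr (a \<odot>\<^bsub>B\<^esub> proj0 p) (a \<odot>\<^bsub>B\<^esub> proj1 p)"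
  "bracket (kernel_pair_algebra B N) ps = Pr (bracket B (map proj0 ps)) (bracket B (map proj1 ps))"
  by (simp_all add: kernel_pair_algebra_def)

lemma kernel_pair_projections:
  assumes "p \<in> carrier (kernel_pair_algebra B N)"
  shows "proj0 p \<in> carrier B" "proj1 p \<in> carrier B" "proj1 p \<ominus>\<^bsub>B\<^esub> proj0 p \<in> N"
    "p = Pr (proj0 p) (proj1 p)"
  using assms by (auto simp: kernel_pair_algebra_simps)

lemma kernel_pair_map_projections:
  assumes "set ps \<subseteq> carrier (kernel_pair_algebra B N)"
  shows "set (map proj0 ps) \<subseteq> carrier B" "set (map proj1 ps) \<subseteq> carrier B"
  using assms kernel_pair_projections(1,2)[of _ B N] by auto

lemma kernel_pair_algebra_is_leibniz:
  fixes B :: "('k, 'a pairs) leibniz"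
  assumes B: "leibniz_algebra n K B" and n: "n > 0" and N: "leibniz_ideal n K B N"
  shows "leibniz_algebra n K (kernel_pair_algebra B N)" (is "leibniz_algebra n K ?R")
proof -
  interpret B: leibniz_algebra n K B by fact
  have N': "submodule N K B"
    using N by (simp add: leibniz_ideal_def)
  have diff: "bracket B (map proj1 ps) \<ominus>\<^bsub>B\<^esub> bracket B (map proj0 ps) \<in> N"
    if ps: "length ps = n" "set ps \<subseteq> carrier ?R" for ps
  proof -
    have "bracket B (map proj1 ps) \<ominus>\<^bsub>B\<^esub> bracket B (map proj0 ps)
        \<in> meeting_span n K B (\<lambda>_. N) ({()})"
      using ps kernel_pair_map_projections[OF ps(2)]
      by (intro B.bracket_difference_in_meeting_span)
        (auto intro!: kernel_pair_projections(3))
    then show ?thesis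
      using B.meeting_span_subset_ideal[of "()" "{()}" "\<lambda>_. N"] N by auto
  qed
  show ?thesis
  proof (rule leibniz_algebra_jointly_injective[OF B n, where S = UNIV
        and h = "\<lambda>s. if s then proj1 else proj0"])
    show "x = y" if "x \<in> carrier ?R" "y \<in> carrier ?R"
      "\<And>s. s \<in> UNIV \<Longrightarrow> (if s then proj1 else proj0) x = (if s then proj1 else proj0) y" for x y
      using that(1,2) that(3)[of True] that(3)[of False] by (auto simp: kernel_pair_algebra_simps)
  next
    show "\<zero>\<^bsub>?R\<^esub> \<in> carrier ?R"
      using B.submodule_zero[OF N'] B.submodule_minus[OF N']
      by (simp add: kernel_pair_algebra_simps)
  next
    fix p q assume "p \<in> carrier ?R" "q \<in> carrier ?R"
    then obtain x y x' y' where p: "p = Pr x y" "x \<in> carrier B" "y \<in> carrier B" "y \<ominus>\<^bsub>B\<^esub> x \<in> N"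
      and q: "q = Pr x' y'" "x' \<in> carrier B" "y' \<in> carrier B" "y' \<ominus>\<^bsub>B\<^esub> x' \<in> N"
      by (auto simp: kernel_pair_algebra_simps)
    have "(y \<oplus>\<^bsub>B\<^esub> y') \<ominus>\<^bsub>B\<^esub> (x \<oplus>\<^bsub>B\<^esub> x') = (y \<ominus>\<^bsub>B\<^esub> x) \<oplus>\<^bsub>B\<^esub> (y' \<ominus>\<^bsub>B\<^esub> x')"
      using p q by (simp add: a_minus_def B.M.minus_add B.M.a_ac)
    then show "p \<oplus>\<^bsub>?R\<^esub> q \<in> carrier ?R"
      using p q B.submoduleE(5)[OF N'] by (simp add: kernel_pair_algebra_simps)
  next
    fix p assume "p \<in> carrier ?R"
    then obtain x y where p: "p = Pr x y" "x \<in> carrier B" "y \<in> carrier B" "y \<ominus>\<^bsub>B\<^esub> x \<in> N"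
      by (auto simp: kernel_pair_algebra_simps)
    have "\<ominus>\<^bsub>B\<^esub> y \<ominus>\<^bsub>B\<^esub> (\<ominus>\<^bsub>B\<^esub> x) = \<ominus>\<^bsub>B\<^esub> (y \<ominus>\<^bsub>B\<^esub> x)"
      using p by (simp add: a_minus_def B.M.minus_add)
    then have "Pr (\<ominus>\<^bsub>B\<^esub> x) (\<ominus>\<^bsub>B\<^esub> y) \<in> carrier ?R"
      using p B.submoduleE(3)[OF N'] by (simp add: kernel_pair_algebra_simps)
    then show "\<exists>q\<in>carrier ?R. \<forall>s\<in>UNIV. (if s then proj1 else proj0) q =
        \<ominus>\<^bsub>B\<^esub> (if s then proj1 else proj0) p"
      by (rule bexI[rotated]) (simp add: p(1))
  next
    fix a p assume a: "a \<in> carrier K" and "p \<in> carrier ?R"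
    then obtain x y where p: "p = Pr x y" "x \<in> carrier B" "y \<in> carrier B" "y \<ominus>\<^bsub>B\<^esub> x \<in> N"
      by (auto simp: kernel_pair_algebra_simps)
    have "a \<odot>\<^bsub>B\<^esub> y \<ominus>\<^bsub>B\<^esub> a \<odot>\<^bsub>B\<^esub> x = a \<odot>\<^bsub>B\<^esub> (y \<ominus>\<^bsub>B\<^esub> x)"
      using p a by (simp add: a_minus_def B.smult_r_distr B.smult_r_minus)
    then show "a \<odot>\<^bsub>?R\<^esub> p \<in> carrier ?R"
      using p a B.submoduleE(4)[OF N'] by (simp add: kernel_pair_algebra_simps)
  next
    fix ps assume ps: "length ps = n" "set ps \<subseteq> carrier ?R"
    then show "bracket ?R ps \<in> carrier ?R"
      using diff[OF ps] kernel_pair_map_projections[OF ps(2)]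
      by (simp add: kernel_pair_algebra_simps B.bracket_closed del: set_map)
  qed (simp_all add: kernel_pair_algebra_simps(2-5) kernel_pair_projections(1,2))
qed

lemma kernel_pair_difference_linear:
  fixes B :: "('k, 'a pairs) leibniz"
  assumes "leibniz_algebra n K B"
  shows "linear_map K (kernel_pair_algebra B N) B (\<lambda>p. proj1 p \<ominus>\<^bsub>B\<^esub> proj0 p)"
proof -
  interpret B: leibniz_algebra n K B by fact
  show ?thesis
    unfolding linear_map_def
    by (auto simp: kernel_pair_algebra_simps a_minus_def B.M.minus_add B.M.a_ac
        B.smult_r_distr B.smult_r_minus)
qed

lemma kernel_pair_projections_linear:
  fixes B :: "('k, 'a pairs) leibniz"
  shows "linear_map K (kernel_pair_algebra B N) B proj0" "linear_map K (kernel_pair_algebra B N) B proj1"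
  unfolding linear_map_def by (auto simp: kernel_pair_algebra_simps)

text \<open>The linear structure behind viewing the kernel of the first projection as a subspace of \<open>B\<close> via
  the second projection.\<close>

lemma kernel_pair_fibre_submodule:
  fixes B :: "('k, 'a pairs) leibniz"
  assumes "leibniz_algebra n K B" and S: "submodule S K (kernel_pair_algebra B N)"
    and "module K (kernel_pair_algebra B N)"
  shows "submodule {k \<in> carrier B. Pr \<zero>\<^bsub>B\<^esub> k \<in> S} K B" (is "submodule ?F K B")
proof -
  interpret B: leibniz_algebra n K B by fact
  interpret R: module K "kernel_pair_algebra B N" by fact
  have smult: "a \<odot>\<^bsub>B\<^esub> k \<in> ?F" if "a \<in> carrier K" "k \<in> ?F" for a k
    using R.submoduleE(4)[OF S, of a "Pr \<zero>\<^bsub>B\<^esub> k"] that by (simp add: kernel_pair_algebra_simps)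
  show ?thesis
  proof (rule B.submoduleI)
    show "\<zero>\<^bsub>B\<^esub> \<in> ?F"
      using R.submodule_zero[OF S] by (simp add: kernel_pair_algebra_simps)
    show "k \<oplus>\<^bsub>B\<^esub> l \<in> ?F" if "k \<in> ?F" "l \<in> ?F" for k l
      using R.submoduleE(5)[OF S, of "Pr \<zero>\<^bsub>B\<^esub> k" "Pr \<zero>\<^bsub>B\<^esub> l"] that
      by (simp add: kernel_pair_algebra_simps)
    show "\<ominus>\<^bsub>B\<^esub> k \<in> ?F" if "k \<in> ?F" for k
      using smult[of "\<ominus>\<^bsub>K\<^esub> \<one>\<^bsub>K\<^esub>" k] that B.smult_l_minus[of "\<one>\<^bsub>K\<^esub>" k] by simp
  qed (use smult in auto)
qed

text \<open>The comparison between brackets of pairs meeting \<open>A\<close> and brackets in \<open>B\<close> meeting one more index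
  \<open>m\<close>. The first part holds because the difference of the components is linear and telescopes on
  brackets, the second because entries in \<open>N m\<close> can be lifted with first component zero.\<close>

lemma meeting_span_kernel_pair:
  fixes B :: "('k, 'a pairs) leibniz" and N :: "'i \<Rightarrow> 'a pairs set" and A :: "'i set"
  assumes B: "leibniz_algebra n K B" and n: "n > 0"
    and N: "\<And>i. i \<in> insert m A \<Longrightarrow> leibniz_ideal n K B (N i)"
  defines "R \<equiv> kernel_pair_algebra B (N m)"
    and "N' \<equiv> \<lambda>i. {p \<in> carrier (kernel_pair_algebra B (N m)). proj0 p \<in> N i \<and> proj1 p \<in> N i}"
  shows "p \<in> meeting_span n K R N' A \<Longrightarrow>
      proj1 p \<ominus>\<^bsub>B\<^esub> proj0 p \<in> meeting_span n K B N (insert m A)"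
    and "k \<in> meeting_span n K B N (insert m A) \<Longrightarrow> Pr \<zero>\<^bsub>B\<^esub> k \<in> meeting_span n K R N' A"
proof -
  interpret B: leibniz_algebra n K B by fact
  interpret R: leibniz_algebra n K R
    unfolding R_def by (rule kernel_pair_algebra_is_leibniz[OF B n]) (simp add: N)
  have sub: "submodule (N i) K B" if "i \<in> insert m A" for i
    using N[OF that] by (simp add: leibniz_ideal_def)
  show "proj1 p \<ominus>\<^bsub>B\<^esub> proj0 p \<in> meeting_span n K B N (insert m A)"
    if p: "p \<in> meeting_span n K R N' A"
  proof (rule R.linear_map_span[OF _ B.module_L B.meeting_span_submodule
        R.meeting_brackets_carrier _ p[unfolded meeting_span_def]])
    show "linear_map K R B (\<lambda>p. proj1 p \<ominus>\<^bsub>B\<^esub> proj0 p)"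
      unfolding R_def by (rule kernel_pair_difference_linear[OF B])
    show "(\<lambda>p. proj1 p \<ominus>\<^bsub>B\<^esub> proj0 p) ` meeting_brackets n R N' A
        \<subseteq> meeting_span n K B N (insert m A)"
    proof (rule image_subsetI)
      fix q assume "q \<in> meeting_brackets n R N' A"
      then obtain ps where q: "q = bracket R ps" and ps: "length ps = n" "set ps \<subseteq> carrier R"
        and hit: "\<And>i. i \<in> A \<Longrightarrow> \<exists>p\<in>set ps. p \<in> N' i"
        unfolding meeting_brackets_def by blast
      have "bracket B (map proj1 ps) \<ominus>\<^bsub>B\<^esub> bracket B (map proj0 ps)
          \<in> meeting_span n K B N (insert m A)"
      proof (rule B.bracket_difference_in_meeting_span)
        show "map proj1 ps ! j \<ominus>\<^bsub>B\<^esub> map proj0 ps ! j \<in> N m" if "j < n" for j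
          using that ps subsetD[OF ps(2), of "ps ! j"] kernel_pair_projections(3)[of "ps ! j" B "N m"]
          by (simp add: R_def)
        fix i assume "i \<in> A"
        then obtain p where "p \<in> set ps" "p \<in> N' i"
          using hit by blast
        then show "\<exists>j<n. map proj0 ps ! j \<in> N i \<and> map proj1 ps ! j \<in> N i"
          using ps(1) by (auto simp: in_set_conv_nth N'_def)
      qed (use ps kernel_pair_map_projections[OF ps(2)[unfolded R_def]] sub in simp_all)
      then show "proj1 q \<ominus>\<^bsub>B\<^esub> proj0 q \<in> meeting_span n K B N (insert m A)"
        by (simp add: q R_def kernel_pair_algebra_simps)
    qed
  qed
  have "meeting_span n K B N (insert m A)
      \<subseteq> {k \<in> carrier B. Pr \<zero>\<^bsub>B\<^esub> k \<in> meeting_span n K R N' A}"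
    unfolding meeting_span_def[of n K B]
  proof (rule B.linear_span_least)
    show "submodule {k \<in> carrier B. Pr \<zero>\<^bsub>B\<^esub> k \<in> meeting_span n K R N' A} K B"
      using kernel_pair_fibre_submodule[OF B R.meeting_span_submodule[unfolded R_def]]
        R.module_L by (simp add: R_def)
    show "meeting_brackets n B N (insert m A)
        \<subseteq> {k \<in> carrier B. Pr \<zero>\<^bsub>B\<^esub> k \<in> meeting_span n K R N' A}"
    proof
      fix b assume "b \<in> meeting_brackets n B N (insert m A)"
      then obtain xs where b: "b = bracket B xs" and xs: "length xs = n" "set xs \<subseteq> carrier B"
        and hit: "\<And>i. i \<in> insert m A \<Longrightarrow> \<exists>x\<in>set xs. x \<in> N i"
        unfolding meeting_brackets_def by blast
      \<comment> \<open>Both components of a lift lie in \<open>N i\<close> if \<open>x\<close> does, so lifting keeps all indices in \<open>A\<close> met.\<close>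
      define lift where "lift x = Pr (if x \<in> N m then \<zero>\<^bsub>B\<^esub> else x) x" for x
      have lift: "lift x \<in> carrier R" if "x \<in> carrier B" for x
        using that B.submodule_zero[OF sub, of m]
        by (simp add: lift_def R_def kernel_pair_algebra_simps B.minus_zero_right
            B.minus_eq_zero_iff[THEN iffD2])
      have "bracket R (map lift xs) \<in> meeting_span n K R N' A"
      proof (rule R.meeting_span_bracket)
        show "set (map lift xs) \<subseteq> carrier R"
          using lift xs(2) by auto
        fix i assume i: "i \<in> A"
        then obtain x where x: "x \<in> set xs" "x \<in> N i"
          using hit by blast
        then have "lift x \<in> N' i"
          using lift[of x] xs(2) B.submodule_zero[OF sub, of i] i
          by (auto simp: N'_def R_def lift_def)
        then show "\<exists>p\<in>set (map lift xs). p \<in> N' i"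
          using x(1) by auto
      qed (use xs in simp)
      moreover have "bracket B (map (proj0 \<circ> lift) xs) = \<zero>\<^bsub>B\<^esub>"
      proof (rule B.bracket_zero)
        obtain x where "x \<in> set xs" "x \<in> N m"
          using hit by blast
        then show "\<zero>\<^bsub>B\<^esub> \<in> set (map (proj0 \<circ> lift) xs)"
          by (force simp: lift_def)
      qed (use xs in \<open>auto simp: lift_def\<close>)
      moreover have "map (proj1 \<circ> lift) xs = xs"
        by (simp add: lift_def map_idI)
      ultimately show "b \<in> {k \<in> carrier B. Pr \<zero>\<^bsub>B\<^esub> k \<in> meeting_span n K R N' A}"
        using B.bracket_closed[OF xs] by (simp add: b R_def kernel_pair_algebra_simps)
    qed
  qed
  then show "k \<in> meeting_span n K B N (insert m A) \<Longrightarrow> Pr \<zero>\<^bsub>B\<^esub> k \<in> meeting_span n K R N' A"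
    by blast
qed

lemma kernel_pair_ideal:
  fixes B :: "('k, 'a pairs) leibniz"
  assumes B: "leibniz_algebra n K B" and R: "leibniz_algebra n K (kernel_pair_algebra B N)"
    and I: "leibniz_ideal n K B I"
  shows "leibniz_ideal n K (kernel_pair_algebra B N)
    {p \<in> carrier (kernel_pair_algebra B N). proj0 p \<in> I \<and> proj1 p \<in> I}"
    (is "leibniz_ideal n K ?R ?I")
proof -
  interpret B: leibniz_algebra n K B by fact
  interpret R: leibniz_algebra n K ?R by fact
  have "submodule I K B"
    using I by (simp add: leibniz_ideal_def)
  then have "submodule {p \<in> carrier ?R. proj0 p \<in> I} K ?R" "submodule {p \<in> carrier ?R. proj1 p \<in> I} K ?R"
    using kernel_pair_projections_linear[of K B N] R.submodule_preimage B.module_L by blast+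
  then have "submodule (\<Inter>{{p \<in> carrier ?R. proj0 p \<in> I}, {p \<in> carrier ?R. proj1 p \<in> I}}) K ?R"
    by (intro R.submodule_Inter) auto
  also have "\<Inter>{{p \<in> carrier ?R. proj0 p \<in> I}, {p \<in> carrier ?R. proj1 p \<in> I}} = ?I"
    by auto
  finally have "submodule ?I K ?R" .
  moreover have "bracket ?R ps \<in> ?I"
    if ps: "length ps = n" "set ps \<subseteq> carrier ?R" and p: "p \<in> set ps" "p \<in> ?I" for ps p
  proof -
    have "\<exists>x\<in>set (map proj0 ps). x \<in> I" "\<exists>x\<in>set (map proj1 ps). x \<in> I"
      using p by auto
    then have "bracket B (map proj0 ps) \<in> I" "bracket B (map proj1 ps) \<in> I"
      using I ps(1) kernel_pair_map_projections[OF ps(2)] unfolding leibniz_ideal_def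
      by (metis length_map)+
    then show ?thesis
      using R.bracket_closed[OF ps] by (simp add: kernel_pair_algebra_simps(5))
  qed
  ultimately show ?thesis
    unfolding leibniz_ideal_def by blast
qed

section \<open>Edge kernels of a higher arrow and of its kernel pair\<close>

text \<open>What the recursion for \<open>L\<^sub>m\<close> uses of an \<open>m\<close>-fold arrow: its object at the empty set and the kernels
  of the maps \<open>f\<^sub>i\<close>. This data passes from an arrow to its kernel pair by a computation in the
  single algebra of pairs \<open>kernel_pair_algebra\<close>.\<close>

definition has_edge_ideals ::
    "nat \<Rightarrow> ('k, 'c) ring_scheme \<Rightarrow> nat \<Rightarrow> ('k, 'a) fold_arrow \<Rightarrow> bool" where
  "has_edge_ideals n K m f \<longleftrightarrow>
    leibniz_algebra n K (obj f {}) \<and>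
    (\<forall>i\<in>{1..m}. leibniz_ideal n K (obj f {}) (edge_kernel f i) \<and>
      (\<forall>x\<in>carrier (obj f {}). \<forall>y\<in>carrier (obj f {}).
        arr f {} {i} x = arr f {} {i} y \<longleftrightarrow> y \<ominus>\<^bsub>obj f {}\<^esub> x \<in> edge_kernel f i))"

lemma edge_kernel_iff:
  "x \<in> edge_kernel f i \<longleftrightarrow> x \<in> carrier (obj f {}) \<and> arr f {} {i} x = \<zero>\<^bsub>obj f {i}\<^esub>"
  by (simp add: edge_kernel_def a_kernel_def')

lemma fold_arrow_has_edge_ideals:
  assumes f: "is_fold_arrow n K m f"
  shows "has_edge_ideals n K m f"
  unfolding has_edge_ideals_def
proof (intro conjI ballI)
  let ?B = "obj f {}"
  note algs = f[unfolded is_fold_arrow_def, THEN conjunct1, rule_format]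
    and homs = f[unfolded is_fold_arrow_def, THEN conjunct2, THEN conjunct1, rule_format]
  show B: "leibniz_algebra n K ?B"
    by (rule algs) simp
  then interpret B: leibniz_algebra n K ?B .
  fix i assume i: "i \<in> {1..m}"
  let ?A = "obj f {i}"
  let ?h = "arr f {} {i}"
  have "{i} \<subseteq> {1..m}"
    using i by simp
  then have A: "leibniz_algebra n K ?A" and hom: "?h \<in> leibniz_hom n K ?B ?A"
    by (simp_all add: algs homs)
  interpret A: leibniz_algebra n K ?A by fact
  have lin: "linear_map K ?B ?A ?h"
    by (rule leibniz_hom_linear[OF hom])
  show "leibniz_ideal n K ?B (edge_kernel f i)"
    unfolding leibniz_ideal_def
  proof (intro conjI allI impI)
    have "submodule {\<zero>\<^bsub>?A\<^esub>} K ?A"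
      by (intro A.submoduleI) (simp_all add: A.a_inv_zero)
    from B.submodule_preimage[OF lin A.module_L this]
    show "submodule (edge_kernel f i) K ?B"
      by (simp add: edge_kernel_def a_kernel_def')
    fix xs assume xs: "length xs = n \<and> set xs \<subseteq> carrier ?B \<and> (\<exists>x\<in>set xs. x \<in> edge_kernel f i)"
    then have "?h (bracket ?B xs) = bracket ?A (map ?h xs)"
      using hom by (simp add: leibniz_hom_def)
    also have "\<dots> = \<zero>\<^bsub>?A\<^esub>"
    proof (rule A.bracket_zero)
      show "set (map ?h xs) \<subseteq> carrier ?A"
        using xs lin unfolding linear_map_def by auto
      show "\<zero>\<^bsub>?A\<^esub> \<in> set (map ?h xs)"
        using xs by (force simp: edge_kernel_iff)
    qed (use xs in simp)
    finally show "bracket ?B xs \<in> edge_kernel f i"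
      using xs B.bracket_closed by (simp add: edge_kernel_iff)
  qed
  fix x y assume xy: "x \<in> carrier ?B" "y \<in> carrier ?B"
  then have c: "?h x \<in> carrier ?A" "?h y \<in> carrier ?A"
    using lin unfolding linear_map_def by auto
  have "y \<ominus>\<^bsub>?B\<^esub> x \<in> edge_kernel f i \<longleftrightarrow> ?h y \<ominus>\<^bsub>?A\<^esub> ?h x = \<zero>\<^bsub>?A\<^esub>"
    using xy B.linear_map_minus[OF lin A.module_L xy(2,1)] by (simp add: edge_kernel_iff)
  also have "\<dots> \<longleftrightarrow> ?h x = ?h y"
    using c A.minus_eq_zero_iff by metis
  finally show "?h x = ?h y \<longleftrightarrow> y \<ominus>\<^bsub>?B\<^esub> x \<in> edge_kernel f i" ..
qed

lemma obj_kernel_pair: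
  assumes "has_edge_ideals n K m f" and "m \<ge> 1"
  shows "obj (kernel_pair m f) {} = kernel_pair_algebra (obj f {}) (edge_kernel f m)"
proof -
  have "{Pr x y | x y. x \<in> carrier (obj f {}) \<and> y \<in> carrier (obj f {}) \<and>
        arr f {} {m} x = arr f {} {m} y} =
      {Pr x y | x y. x \<in> carrier (obj f {}) \<and> y \<in> carrier (obj f {}) \<and>
        y \<ominus>\<^bsub>obj f {}\<^esub> x \<in> edge_kernel f m}"
    using assms unfolding has_edge_ideals_def by (intro Collect_cong) (metis atLeastAtMost_iff order_refl)
  then show ?thesis
    by (simp add: kernel_pair_def kernel_pair_algebra_def Let_def)
qed

lemma edge_kernel_kernel_pair:
  assumes "has_edge_ideals n K m f" and "m \<ge> 1"
  shows "edge_kernel (kernel_pair m f) i =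
    {p \<in> carrier (kernel_pair_algebra (obj f {}) (edge_kernel f m)).
      proj0 p \<in> edge_kernel f i \<and> proj1 p \<in> edge_kernel f i}"
proof (rule Set.set_eqI)
  fix p
  have "p \<in> edge_kernel (kernel_pair m f) i \<longleftrightarrow>
      p \<in> carrier (kernel_pair_algebra (obj f {}) (edge_kernel f m)) \<and>
      arr f {} {i} (proj0 p) = \<zero>\<^bsub>obj f {i}\<^esub> \<and> arr f {} {i} (proj1 p) = \<zero>\<^bsub>obj f {i}\<^esub>"
    unfolding edge_kernel_iff obj_kernel_pair[OF assms] by (simp add: kernel_pair_def Let_def)
  then show "p \<in> edge_kernel (kernel_pair m f) i \<longleftrightarrow>
      p \<in> {p \<in> carrier (kernel_pair_algebra (obj f {}) (edge_kernel f m)).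
        proj0 p \<in> edge_kernel f i \<and> proj1 p \<in> edge_kernel f i}"
    using kernel_pair_projections(1,2)[of p "obj f {}" "edge_kernel f m"] by (auto simp: edge_kernel_iff)
qed

lemma kernel_pair_has_edge_ideals:
  assumes f: "has_edge_ideals n K (Suc m) f" and n: "n > 0"
  shows "has_edge_ideals n K m (kernel_pair (Suc m) f)"
proof -
  let ?B = "obj f {}"
  let ?R = "kernel_pair_algebra ?B (edge_kernel f (Suc m))"
  have B: "leibniz_algebra n K ?B" and I: "\<And>i. i \<in> {1..Suc m} \<Longrightarrow> leibniz_ideal n K ?B (edge_kernel f i)"
    and eq: "\<And>i x y. \<lbrakk>i \<in> {1..Suc m}; x \<in> carrier ?B; y \<in> carrier ?B\<rbrakk> \<Longrightarrow>
      arr f {} {i} x = arr f {} {i} y \<longleftrightarrow> y \<ominus>\<^bsub>?B\<^esub> x \<in> edge_kernel f i"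
    using f unfolding has_edge_ideals_def by blast+
  have R: "leibniz_algebra n K ?R"
    using I by (intro kernel_pair_algebra_is_leibniz B n) simp
  interpret B: leibniz_algebra n K ?B by fact
  interpret R: leibniz_algebra n K ?R by fact
  have obj: "obj (kernel_pair (Suc m) f) {} = ?R"
    by (rule obj_kernel_pair[OF f]) simp
  have ker: "edge_kernel (kernel_pair (Suc m) f) i =
      {p \<in> carrier ?R. proj0 p \<in> edge_kernel f i \<and> proj1 p \<in> edge_kernel f i}" for i
    by (simp add: edge_kernel_kernel_pair[OF f])
  show ?thesis
    unfolding has_edge_ideals_def obj ker
  proof (intro conjI ballI R)
    fix i assume "i \<in> {1..m}"
    then have i: "i \<in> {1..Suc m}"
      by simp
    show "leibniz_ideal n K ?R {p \<in> carrier ?R. proj0 p \<in> edge_kernel f i \<and> proj1 p \<in> edge_kernel f i}"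
      by (rule kernel_pair_ideal[OF B R I[OF i]])
    fix p q assume pq: "p \<in> carrier ?R" "q \<in> carrier ?R"
    note c = kernel_pair_projections(1,2)[OF pq(1)] kernel_pair_projections(1,2)[OF pq(2)]
    have "proj0 (q \<ominus>\<^bsub>?R\<^esub> p) = proj0 q \<ominus>\<^bsub>?B\<^esub> proj0 p" "proj1 (q \<ominus>\<^bsub>?R\<^esub> p) = proj1 q \<ominus>\<^bsub>?B\<^esub> proj1 p"
      using R.linear_map_minus[OF _ B.module_L pq(2,1)] kernel_pair_projections_linear by blast+
    then show "arr (kernel_pair (Suc m) f) {} {i} p = arr (kernel_pair (Suc m) f) {} {i} q \<longleftrightarrow>
        q \<ominus>\<^bsub>?R\<^esub> p \<in> {p \<in> carrier ?R. proj0 p \<in> edge_kernel f i \<and> proj1 p \<in> edge_kernel f i}"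
      using R.M.minus_closed[OF pq(2,1)] eq[OF i c(1) c(3)] eq[OF i c(2) c(4)]
      by (simp add: kernel_pair_def)
  qed
qed

section \<open>The iterated kernel pair\<close>

text \<open>The step from \<open>m\<close> to \<open>m + 1\<close>: the indices \<open>1..m\<close> come from the edges of the kernel pair, and the
  index \<open>m + 1\<close> from the direction in which the kernel pair is taken.\<close>

lemma meeting_span_kernel_pair_arrow:
  assumes f: "has_edge_ideals n K (Suc m) f" and n: "n > 0"
  defines "S \<equiv> meeting_span n K (obj f {}) (edge_kernel f) {1..Suc m}"
    and "T \<equiv> meeting_span n K (obj (kernel_pair (Suc m) f) {})
      (edge_kernel (kernel_pair (Suc m) f)) {1..m}"
  shows "p \<in> T \<Longrightarrow> proj0 p \<in> carrier (obj f {}) \<and> proj1 p \<in> carrier (obj f {}) \<and>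
      proj1 p \<ominus>\<^bsub>obj f {}\<^esub> proj0 p \<in> S"
    and "k \<in> carrier (obj f {}) \<Longrightarrow> Pr \<zero>\<^bsub>obj f {}\<^esub> k \<in> T \<longleftrightarrow> k \<in> S"
proof -
  let ?B = "obj f {}"
  let ?R = "kernel_pair_algebra ?B (edge_kernel f (Suc m))"
  have B: "leibniz_algebra n K ?B"
    and I: "\<And>i. i \<in> insert (Suc m) {1..m} \<Longrightarrow> leibniz_ideal n K ?B (edge_kernel f i)"
    using f unfolding has_edge_ideals_def by auto
  interpret B: leibniz_algebra n K ?B by fact
  have obj: "obj (kernel_pair (Suc m) f) {} = ?R"
    by (simp add: obj_kernel_pair[OF f])
  interpret R: leibniz_algebra n K ?R
    by (rule kernel_pair_algebra_is_leibniz[OF B n I]) simp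
  have m: "insert (Suc m) {1..m} = {1..Suc m}"
    by auto
  have T: "T = meeting_span n K ?R
      (\<lambda>i. {p \<in> carrier ?R. proj0 p \<in> edge_kernel f i \<and> proj1 p \<in> edge_kernel f i}) {1..m}"
    unfolding T_def obj by (simp add: edge_kernel_kernel_pair[OF f, simplified, abs_def])
  have 1: "proj1 p \<ominus>\<^bsub>?B\<^esub> proj0 p \<in> S" if "p \<in> T" for p
    using meeting_span_kernel_pair(1)[where N = "edge_kernel f" and m = "Suc m" and A = "{1..m}",
        OF B n I] that unfolding T S_def m by blast
  have 2: "Pr \<zero>\<^bsub>?B\<^esub> k \<in> T" if "k \<in> S" for k
    using meeting_span_kernel_pair(2)[where N = "edge_kernel f" and m = "Suc m" and A = "{1..m}",
        OF B n I] that unfolding T S_def m by blast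
  show "proj0 p \<in> carrier ?B \<and> proj1 p \<in> carrier ?B \<and> proj1 p \<ominus>\<^bsub>?B\<^esub> proj0 p \<in> S" if p: "p \<in> T"
  proof -
    have "p \<in> carrier ?R"
      using p R.submoduleE(1)[OF R.meeting_span_submodule] unfolding T by blast
    then show ?thesis
      using 1[OF p] kernel_pair_projections by blast
  qed
  show "Pr \<zero>\<^bsub>?B\<^esub> k \<in> T \<longleftrightarrow> k \<in> S" if "k \<in> carrier ?B"
    using 1[of "Pr \<zero>\<^bsub>?B\<^esub> k"] 2[of k] that by (auto simp: B.minus_zero_right)
qed

lemma L_pairs_eq_meeting_span:
  assumes "has_edge_ideals n K m f" and n: "n > 0"
  shows "L_pairs n K m f = meeting_span n K (obj f {}) (edge_kernel f) {1..m}"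
  using assms(1)
proof (induction m arbitrary: f)
  case 0
  then interpret B: leibniz_algebra n K "obj f {}"
    by (simp add: has_edge_ideals_def)
  show ?case
    by (simp add: B.derived_ideal_eq_meeting_span)
next
  case (Suc m)
  interpret B: leibniz_algebra n K "obj f {}"
    using Suc.prems by (simp add: has_edge_ideals_def)
  have IH: "L_pairs n K m (kernel_pair (Suc m) f) = meeting_span n K (obj (kernel_pair (Suc m) f) {})
      (edge_kernel (kernel_pair (Suc m) f)) {1..m}"
    by (rule Suc.IH[OF kernel_pair_has_edge_ideals[OF Suc.prems n]])
  show ?case
    using B.submoduleE(1)[OF B.meeting_span_submodule[of "edge_kernel f" "{1..Suc m}"]]
    unfolding L_pairs.simps IH by (auto simp only: meeting_span_kernel_pair_arrow(2)[OF Suc.prems n])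
qed

text \<open>If the projections agree, then \<open>(0, k)\<close> can only lie in \<open>L\<^sub>m[R[f]]\<close> for \<open>k = 0\<close>. Conversely, the
  difference of the components of any pair in \<open>L\<^sub>m[R[f]]\<close> lies in \<open>L\<^bsub>m+1\<^esub>[f]\<close>.\<close>

lemma projections_agree_iff_L_pairs_zero:
  assumes f: "has_edge_ideals n K (Suc m) f" and n: "n > 0"
  shows "(\<forall>p\<in>L_pairs n K m (kernel_pair (Suc m) f). proj0 p = proj1 p) \<longleftrightarrow>
    L_pairs n K (Suc m) f = {\<zero>\<^bsub>obj f {}\<^esub>}" (is "?agree \<longleftrightarrow> ?zero")
proof
  interpret B: leibniz_algebra n K "obj f {}"
    using f by (simp add: has_edge_ideals_def)
  have "\<zero>\<^bsub>obj f {}\<^esub> \<in> L_pairs n K (Suc m) f"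
    unfolding L_pairs_eq_meeting_span[OF f n] by (rule B.submodule_zero[OF B.meeting_span_submodule])
  then show ?zero if ?agree
    using that by auto
  show ?agree if ?zero
  proof
    fix p assume "p \<in> L_pairs n K m (kernel_pair (Suc m) f)"
    then have p: "proj0 p \<in> carrier (obj f {})" "proj1 p \<in> carrier (obj f {})"
      and "proj1 p \<ominus>\<^bsub>obj f {}\<^esub> proj0 p \<in> L_pairs n K (Suc m) f"
      using meeting_span_kernel_pair_arrow(1)[OF f n]
      unfolding L_pairs_eq_meeting_span[OF f n]
        L_pairs_eq_meeting_span[OF kernel_pair_has_edge_ideals[OF f n] n] by blast+
    then show "proj0 p = proj1 p"
      using \<open>?zero\<close> B.minus_eq_zero_iff[OF p(2,1)] by (metis singletonD)
  qed
qed

section \<open>The copy of an algebra among formal pairs\<close>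

lemma (in leibniz_algebra) meeting_span_hom:
  assumes h: "h \<in> leibniz_hom n K L M" and M: "leibniz_algebra n K M"
    and N: "\<And>i x. \<lbrakk>i \<in> A; x \<in> carrier L; x \<in> N i\<rbrakk> \<Longrightarrow> h x \<in> N' i"
    and x: "x \<in> meeting_span n K L N A"
  shows "h x \<in> meeting_span n K M N' A"
proof -
  interpret M: leibniz_algebra n K M by fact
  have lin: "linear_map K L M h"
    by (rule leibniz_hom_linear[OF h])
  show ?thesis
  proof (rule linear_map_span[OF lin M.module_L M.meeting_span_submodule meeting_brackets_carrier _
        x[unfolded meeting_span_def]])
    show "h ` meeting_brackets n L N A \<subseteq> meeting_span n K M N' A"
    proof (rule image_subsetI)
      fix b assume "b \<in> meeting_brackets n L N A"
      then obtain xs where b: "b = bracket L xs" and xs: "length xs = n" "set xs \<subseteq> carrier L"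
        and hit: "\<And>i. i \<in> A \<Longrightarrow> \<exists>x\<in>set xs. x \<in> N i"
        unfolding meeting_brackets_def by blast
      have "bracket M (map h xs) \<in> meeting_span n K M N' A"
      proof (rule M.meeting_span_bracket)
        show "set (map h xs) \<subseteq> carrier M"
          using xs(2) lin unfolding linear_map_def by auto
        show "\<exists>y\<in>set (map h xs). y \<in> N' i" if "i \<in> A" for i
          using hit[OF that] N[OF that] xs(2) by auto
      qed (use xs in simp)
      then show "h b \<in> meeting_span n K M N' A"
        using h xs by (simp add: b leibniz_hom_def)
    qed
  qed
qed

lemma base_algebra_simps:
  "p \<in> carrier (base_algebra L) \<longleftrightarrow> (\<exists>x\<in>carrier L. p = Base x)"
  "\<zero>\<^bsub>base_algebra L\<^esub> = Base \<zero>\<^bsub>L\<^esub>"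
  "p \<oplus>\<^bsub>base_algebra L\<^esub> q = Base (unbase p \<oplus>\<^bsub>L\<^esub> unbase q)"
  "a \<odot>\<^bsub>base_algebra L\<^esub> p = Base (a \<odot>\<^bsub>L\<^esub> unbase p)"
  "bracket (base_algebra L) ps = Base (bracket L (map unbase ps))"
  by (auto simp: base_algebra_def)

lemma base_algebra_is_leibniz:
  assumes L: "leibniz_algebra n K L" and n: "n > 0"
  shows "leibniz_algebra n K (base_algebra L)"
proof -
  interpret L: leibniz_algebra n K L by fact
  have unbase: "set (map unbase ps) \<subseteq> carrier L" if "set ps \<subseteq> carrier (base_algebra L)" for ps
    using that by (auto simp: base_algebra_simps subset_iff)
  show ?thesis
  proof (rule leibniz_algebra_jointly_injective[OF L n, where S = "{()}" and h = "\<lambda>_. unbase"])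
    show "\<exists>q\<in>carrier (base_algebra L). \<forall>s\<in>{()}. unbase q = \<ominus>\<^bsub>L\<^esub> unbase p"
      if "p \<in> carrier (base_algebra L)" for p
      using that by (intro bexI[of _ "Base (\<ominus>\<^bsub>L\<^esub> unbase p)"]) (auto simp: base_algebra_simps)
    show "bracket (base_algebra L) ps \<in> carrier (base_algebra L)"
      if "length ps = n" "set ps \<subseteq> carrier (base_algebra L)" for ps
      using that unbase by (simp add: base_algebra_simps L.bracket_closed del: set_map)
  qed (auto simp: base_algebra_simps)
qed

lemma Base_hom: "Base \<in> leibniz_hom n K L (base_algebra L)"
  by (auto simp: leibniz_hom_def base_algebra_simps comp_def)

lemma unbase_hom: "unbase \<in> leibniz_hom n K (base_algebra L) L"
  by (auto simp: leibniz_hom_def base_algebra_simps)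

lemma edge_kernel_base_arrow: "edge_kernel (base_arrow f) i = Base ` edge_kernel f i"
  by (auto simp: edge_kernel_iff base_arrow_def base_algebra_simps image_iff)

lemma base_arrow_has_edge_ideals:
  assumes f: "has_edge_ideals n K m f" and n: "n > 0"
  shows "has_edge_ideals n K m (base_arrow f)"
proof -
  let ?L = "obj f {}"
  let ?M = "base_algebra ?L"
  have obj: "obj (base_arrow f) {} = ?M"
    by (simp add: base_arrow_def)
  have L: "leibniz_algebra n K ?L"
    using f by (simp add: has_edge_ideals_def)
  have M: "leibniz_algebra n K ?M"
    by (rule base_algebra_is_leibniz[OF L n])
  interpret L: leibniz_algebra n K ?L by fact
  interpret M: leibniz_algebra n K ?M by fact
  have unbase_linear: "linear_map K ?M ?L unbase"
    by (rule leibniz_hom_linear[OF unbase_hom[of n]])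
  have mem: "p \<in> Base ` N \<longleftrightarrow> p \<in> carrier ?M \<and> unbase p \<in> N" if "N \<subseteq> carrier ?L" for p N
    using that by (auto simp: base_algebra_simps image_iff)
  show ?thesis
    unfolding has_edge_ideals_def obj edge_kernel_base_arrow
  proof (intro conjI ballI M)
    fix i assume i: "i \<in> {1..m}"
    have N: "leibniz_ideal n K ?L (edge_kernel f i)"
      using f i by (simp add: has_edge_ideals_def)
    have Nc: "edge_kernel f i \<subseteq> carrier ?L"
      by (auto simp: edge_kernel_iff)
    show "leibniz_ideal n K ?M (Base ` edge_kernel f i)"
      unfolding leibniz_ideal_def
    proof (intro conjI allI impI)
      have "submodule (edge_kernel f i) K ?L"
        using N by (simp add: leibniz_ideal_def)
      from M.submodule_preimage[OF unbase_linear L.module_L this]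
      show "submodule (Base ` edge_kernel f i) K ?M"
        by (simp only: mem[OF Nc, symmetric] Collect_mem_eq)
      fix ps assume ps: "length ps = n \<and> set ps \<subseteq> carrier ?M \<and> (\<exists>p\<in>set ps. p \<in> Base ` edge_kernel f i)"
      then have "length (map unbase ps) = n" "set (map unbase ps) \<subseteq> carrier ?L"
        "\<exists>x\<in>set (map unbase ps). x \<in> edge_kernel f i"
        by (auto simp: base_algebra_simps subset_iff intro!: bexI[rotated])
      then have "bracket ?L (map unbase ps) \<in> edge_kernel f i"
        using N unfolding leibniz_ideal_def by blast
      then show "bracket ?M ps \<in> Base ` edge_kernel f i"
        by (simp add: base_algebra_simps)
    qed
    fix p q assume pq: "p \<in> carrier ?M" "q \<in> carrier ?M"
    then obtain x y where xy: "p = Base x" "x \<in> carrier ?L" "q = Base y" "y \<in> carrier ?L"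
      by (auto simp: base_algebra_simps)
    have "unbase (q \<ominus>\<^bsub>?M\<^esub> p) = y \<ominus>\<^bsub>?L\<^esub> x"
      using M.linear_map_minus[OF unbase_linear L.module_L pq(2,1)] xy by simp
    then show "arr (base_arrow f) {} {i} p = arr (base_arrow f) {} {i} q \<longleftrightarrow>
        q \<ominus>\<^bsub>?M\<^esub> p \<in> Base ` edge_kernel f i"
      using f i xy M.M.minus_closed[OF pq(2,1)] unfolding mem[OF Nc]
      by (simp add: has_edge_ideals_def base_arrow_def)
  qed
qed

text \<open>\<open>Base\<close> and its inverse are homomorphisms that match the edge kernels, so the result computed
  over formal pairs holds for the original algebra.\<close>

lemma L_pairs_base_arrow:
  assumes f: "has_edge_ideals n K m f" and n: "n > 0"
  shows "L_pairs n K m (base_arrow f) = Base ` meeting_span n K (obj f {}) (edge_kernel f) {1..m}"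
proof -
  let ?L = "obj f {}"
  let ?M = "base_algebra ?L"
  have L: "leibniz_algebra n K ?L"
    using f by (simp add: has_edge_ideals_def)
  have M: "leibniz_algebra n K ?M"
    by (rule base_algebra_is_leibniz[OF L n])
  interpret L: leibniz_algebra n K ?L by fact
  interpret M: leibniz_algebra n K ?M by fact
  have obj: "obj (base_arrow f) {} = ?M"
    by (simp add: base_arrow_def)
  have "L_pairs n K m (base_arrow f) = meeting_span n K ?M (\<lambda>i. Base ` edge_kernel f i) {1..m}"
    using L_pairs_eq_meeting_span[OF base_arrow_has_edge_ideals[OF f n] n]
    unfolding edge_kernel_base_arrow[abs_def] obj .
  also have "\<dots> = Base ` meeting_span n K ?L (edge_kernel f) {1..m}"
  proof (intro equalityI subsetI)
    fix p assume p: "p \<in> meeting_span n K ?M (\<lambda>i. Base ` edge_kernel f i) {1..m}"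
    then have "unbase p \<in> meeting_span n K ?L (edge_kernel f) {1..m}"
      by (intro M.meeting_span_hom[OF unbase_hom L _ p]) auto
    moreover have "p = Base (unbase p)"
      using p M.submoduleE(1)[OF M.meeting_span_submodule] by (fastforce simp: base_algebra_simps)
    ultimately show "p \<in> Base ` meeting_span n K ?L (edge_kernel f) {1..m}"
      by blast
  next
    fix p assume "p \<in> Base ` meeting_span n K ?L (edge_kernel f) {1..m}"
    then show "p \<in> meeting_span n K ?M (\<lambda>i. Base ` edge_kernel f i) {1..m}"
      by (auto intro!: L.meeting_span_hom[OF Base_hom M, where N = "edge_kernel f"])
  qed
  finally show ?thesis .
qed

theorem proposition3p6:
  fixes K :: "('k, 'c) ring_scheme" and f :: "('k, 'a) fold_arrow" and n m :: nat
  assumes "field K" and "n \<ge> 2" and "m \<ge> 1" and "is_fold_extension n K m f"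
  shows "(central n K m f \<longleftrightarrow> commutator_sum n K m f = {\<zero>\<^bsub>obj f {}\<^esub>}) \<and>
    commutator_sum n K m f = L_ideal n K m f"
proof -
  let ?L = "obj f {}"
  have n: "n > 0"
    using assms(2) by simp
  have f: "has_edge_ideals n K m f"
    using assms(4) by (intro fold_arrow_has_edge_ideals) (simp add: is_fold_extension_def)
  interpret L: leibniz_algebra n K ?L
    using f by (simp add: has_edge_ideals_def)
  have sum: "commutator_sum n K m f = meeting_span n K ?L (edge_kernel f) {1..m}"
    unfolding commutator_sum_def covers_def
    by (rule L.sum_of_commutators_eq_meeting_span) (use f in \<open>auto simp: has_edge_ideals_def\<close>)
  have L_pairs: "L_pairs n K m (base_arrow f) = Base ` commutator_sum n K m f"
    using L_pairs_base_arrow[OF f n] sum by simp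
  have "commutator_sum n K m f \<subseteq> carrier ?L"
    unfolding sum by (rule L.submoduleE(1)[OF L.meeting_span_submodule])
  then have "commutator_sum n K m f = L_ideal n K m f"
    unfolding L_ideal_def L_pairs by auto
  moreover obtain m' where m': "m = Suc m'"
    using assms(3) by (cases m) auto
  have "central n K m f \<longleftrightarrow> L_pairs n K m (base_arrow f) = {\<zero>\<^bsub>obj (base_arrow f) {}\<^esub>}"
    using projections_agree_iff_L_pairs_zero[OF base_arrow_has_edge_ideals[OF f n, unfolded m'] n]
    by (simp add: central_def m')
  then have "central n K m f \<longleftrightarrow> commutator_sum n K m f = {\<zero>\<^bsub>?L\<^esub>}"
    unfolding L_pairs by (auto simp: base_arrow_def base_algebra_simps image_iff)
  ultimately show ?thesis
    by blast
qed

end
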